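(* Let $\mathbf A,\mathbf B$ be finite algebras in a common locally finite variety with a Taylor term, and let $\rho\in\operatorname{Con}(\mathbf A)$, $\sigma\in\operatorname{Con}(\mathbf B)$ be meet-irreducible with unique upper covers $\rho^+,\sigma^+$. If there exists a good bridge from $(\mathbf A,\rho)$ to $(\mathbf B,\sigma)$, then $\rho^+/\rho$ is abelian if and only if $\sigma^+/\sigma$ is abelian.
   Context: A Taylor term is an idempotent term $t(x_1,\dots,x_n)$, $n>1$, such that for each $i$ an identity $t(u_1,\dots,u_n)\approx t(v_1,\dots,v_n)$ holds with $u_j,v_k\in\{x,y\}$, $\{u_i,v_i\}=\{x,y\}$. A congruence $\rho$ of a finite algebra is meet-irreducible if $\rho\ne1$ and there is $\rho^+\succ\rho$ with $\rho^+\le\beta$ for all congruences $\beta>\rho$. For congruences $\rho\le\theta$, $\theta/\rho$ is abelian if for every term $t(x,\bar y)$, all $(a,b)\in\theta$, $(c_j,d_j)\in\theta$: $t(a,\bar c)\equiv_\rho t(a,\bar d)$ implies $t(b,\bar c)\equiv_\rho t(b,\bar d)$. Bridges: for finite $\mathbf A,\mathbf B$ in a common signature, $\rho\in\operatorname{Con}(\mathbf A)\setminus\{1\}$, $\sigma\in\operatorname{Con}(\mathbf B)\setminus\{1\}$, a bridge from $(\mathbf A,\rho)$ to $(\mathbf B,\sigma)$ is a subuniverse $T\le\mathbf A^2\times\mathbf B^2$ such that (B0* ) $T$ is closed under replacing its first or second coordinate by a $\rho$-related element and its third or fourth by a $\sigma$-related element; (B1* ) $\rho\subsetneq\operatorname{pr}_{1,2}(T)$,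 $\sigma\subsetneq\operatorname{pr}_{3,4}(T)$; (B2* ) for $(a_1,a_2,b_1,b_2)\in T$, $(a_1,a_2)\in\rho\iff(b_1,b_2)\in\sigma$. It is a bridge from $(\mathbf A,\rho,L)$ to $(\mathbf B,\sigma,R)$ if $\operatorname{pr}_{1,2}(T)=L$, $\operatorname{pr}_{3,4}(T)=R$. Trace: $\operatorname{tr}(T)=\{(a,b):(a,a,b,b)\in T\}$. A subuniverse $R\le\mathbf A^2$ is $\rho$-saturated if $R=\rho\circ R\circ\rho$. For meet-irreducible $\rho$, $\operatorname{Cov}^+(\rho)$ is the set of minimal (under inclusion) $\rho$-saturated subuniverses of $\mathbf A^2$ properly containing $\rho$ and contained in $\rho^+$. A bridge $T$ from $(\mathbf A,\rho)$ to $(\mathbf B,\sigma)$ (with $\rho,\sigma$ meet-irreducible) is good if there are $\tau\in\operatorname{Cov}^+(\rho)$, $\tau'\in\operatorname{Cov}^+(\sigma)$ and a bridge $T'\subseteq T$ from $(\mathbf A,\rho,\tau)$ to $(\mathbf B,\sigma,\tau')$ with $\operatorname{tr}(T')=\operatorname{tr}(T)$. *)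

theory Defs
  imports Main
begin

section \<open>Universal algebra\<close>

text \<open>
  A signature is a partial map \<open>sig\<close> from symbols to arities; its domain is the set of
  operation symbols. An algebra lives on a carrier set; its operations are only meaningful
  on argument lists of the right length with entries in the carrier.
\<close>

datatype (dead 'f, vars_trm: 'v) trm = Var 'v | App 'f "('f, 'v) trm list"

record ('f, 'a) algebra =
  carrier :: "'a set"
  opn :: "'f \<Rightarrow> 'a list \<Rightarrow> 'a"

fun wf_trm :: "('f \<rightharpoonup> nat) \<Rightarrow> ('f, 'v) trm \<Rightarrow> bool" where
  "wf_trm sig (Var x) = True"
| "wf_trm sig (App f ts) = (sig f = Some (length ts) \<and> (\<forall>t\<in>set ts. wf_trm sig t))"

fun eval :: "('f, 'a) algebra \<Rightarrow> ('v \<Rightarrow> 'a) \<Rightarrow> ('f, 'v) trm \<Rightarrow> 'a" where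
  "eval A v (Var x) = v x"
| "eval A v (App f ts) = opn A f (map (eval A v) ts)"

definition subuniverse :: "('f \<rightharpoonup> nat) \<Rightarrow> ('f, 'a) algebra \<Rightarrow> 'a set \<Rightarrow> bool" where
  "subuniverse sig A S \<longleftrightarrow> S \<subseteq> carrier A \<and>
     (\<forall>f xs. sig f = Some (length xs) \<longrightarrow> set xs \<subseteq> S \<longrightarrow> opn A f xs \<in> S)"

definition is_algebra :: "('f \<rightharpoonup> nat) \<Rightarrow> ('f, 'a) algebra \<Rightarrow> bool" where
  "is_algebra sig A \<longleftrightarrow> carrier A \<noteq> {} \<and> subuniverse sig A (carrier A)"

definition prod_alg :: "('f, 'a) algebra \<Rightarrow> ('f, 'b) algebra \<Rightarrow> ('f, 'a \<times> 'b) algebra" where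
  "prod_alg A B = \<lparr>carrier = carrier A \<times> carrier B,
     opn = (\<lambda>f xs. (opn A f (map fst xs), opn B f (map snd xs)))\<rparr>"

definition generated :: "('f \<rightharpoonup> nat) \<Rightarrow> ('f, 'a) algebra \<Rightarrow> 'a set \<Rightarrow> 'a set" where
  "generated sig A X = \<Inter>{S. subuniverse sig A S \<and> X \<subseteq> S}"


section \<open>Varieties\<close>

text \<open>
  A variety is the class of models of a set \<open>E\<close> of identities. Identities are pairs of terms
  in countably many variables.
\<close>

type_synonym 'f identity = "('f, nat) trm \<times> ('f, nat) trm"

definition wf_identities :: "('f \<rightharpoonup> nat) \<Rightarrow> 'f identity set \<Rightarrow> bool" where
  "wf_identities sig E \<longleftrightarrow> (\<forall>(s, t)\<in>E. wf_trm sig s \<and> wf_trm sig t)"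

definition satisfies :: "('f, 'a) algebra \<Rightarrow> 'f identity \<Rightarrow> bool" where
  "satisfies A e \<longleftrightarrow>
     (\<forall>v. range v \<subseteq> carrier A \<longrightarrow> eval A v (fst e) = eval A v (snd e))"

definition in_variety :: "('f \<rightharpoonup> nat) \<Rightarrow> 'f identity set \<Rightarrow> ('f, 'a) algebra \<Rightarrow> bool" where
  "in_variety sig E A \<longleftrightarrow> is_algebra sig A \<and> (\<forall>e\<in>E. satisfies A e)"

text \<open>
  HOL cannot quantify over the carrier types of all members of a variety inside a formula.
  The two notions below only concern finitely generated members, and each of these is a
  quotient of the term algebra over the variables of type \<open>nat\<close>, hence isomorphic to an algebra
  whose elements are sets of terms. So quantifying over algebras on the type
  \<open>('f, nat) trm set\<close> loses nothing: an identity failing in some member of the variety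
  already fails in a finitely generated subalgebra of it.
\<close>

type_synonym 'f universe = "('f, nat) trm set"

definition locally_finite :: "('f \<rightharpoonup> nat) \<Rightarrow> 'f identity set \<Rightarrow> bool" where
  "locally_finite sig E \<longleftrightarrow>
     (\<forall>(C :: ('f, 'f universe) algebra) X. in_variety sig E C \<longrightarrow>
        finite X \<longrightarrow> X \<subseteq> carrier C \<longrightarrow> generated sig C X = carrier C \<longrightarrow> finite (carrier C))"

definition holds_in_variety :: "('f \<rightharpoonup> nat) \<Rightarrow> 'f identity set \<Rightarrow> 'f identity \<Rightarrow> bool" where
  "holds_in_variety sig E e \<longleftrightarrow>
     (\<forall>C :: ('f, 'f universe) algebra. in_variety sig E C \<longrightarrow> satisfies C e)"

text \<open>
  The term \<open>t(x\<^sub>1,\<dots>,x\<^sub>n)\<close> has its variables among \<open>0,\<dots>,n - 1\<close>. In the identities the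
  variables \<open>x\<close> and \<open>y\<close> are \<open>0\<close> and \<open>1\<close>, and \<open>t(u\<^sub>1,\<dots>,u\<^sub>n)\<close> is the renaming
  \<open>map_trm u t\<close>.
\<close>

definition taylor_term ::
    "('f \<rightharpoonup> nat) \<Rightarrow> 'f identity set \<Rightarrow> nat \<Rightarrow> ('f, nat) trm \<Rightarrow> bool" where
  "taylor_term sig E n t \<longleftrightarrow>
     n > 1 \<and> wf_trm sig t \<and> vars_trm t \<subseteq> {..<n} \<and>
     holds_in_variety sig E (map_trm (\<lambda>_. 0) t, Var 0) \<and>
     (\<forall>i<n. \<exists>u v :: nat \<Rightarrow> nat.
        (\<forall>j<n. u j \<in> {0, 1} \<and> v j \<in> {0, 1}) \<and> {u i, v i} = {0, 1} \<and>
        holds_in_variety sig E (map_trm u t, map_trm v t))"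


section \<open>Congruences\<close>

definition Con :: "('f \<rightharpoonup> nat) \<Rightarrow> ('f, 'a) algebra \<Rightarrow> 'a rel set" where
  "Con sig A = {\<theta>. equiv (carrier A) \<theta> \<and> subuniverse sig (prod_alg A A) \<theta>}"

definition is_upper_cover ::
    "('f \<rightharpoonup> nat) \<Rightarrow> ('f, 'a) algebra \<Rightarrow> 'a rel \<Rightarrow> 'a rel \<Rightarrow> bool" where
  "is_upper_cover sig A \<rho> \<theta> \<longleftrightarrow>
     \<theta> \<in> Con sig A \<and> \<rho> \<subset> \<theta> \<and> \<not> (\<exists>\<gamma>\<in>Con sig A. \<rho> \<subset> \<gamma> \<and> \<gamma> \<subset> \<theta>) \<and>
     (\<forall>\<beta>\<in>Con sig A. \<rho> \<subset> \<beta> \<longrightarrow> \<theta> \<subseteq> \<beta>)"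

definition meet_irreducible :: "('f \<rightharpoonup> nat) \<Rightarrow> ('f, 'a) algebra \<Rightarrow> 'a rel \<Rightarrow> bool" where
  "meet_irreducible sig A \<rho> \<longleftrightarrow>
     \<rho> \<in> Con sig A \<and> \<rho> \<noteq> carrier A \<times> carrier A \<and> (\<exists>\<theta>. is_upper_cover sig A \<rho> \<theta>)"

definition upper_cover :: "('f \<rightharpoonup> nat) \<Rightarrow> ('f, 'a) algebra \<Rightarrow> 'a rel \<Rightarrow> 'a rel" where
  "upper_cover sig A \<rho> = (THE \<theta>. is_upper_cover sig A \<rho> \<theta>)"

lemma upper_cover_eq: "is_upper_cover sig A \<rho> \<theta> \<Longrightarrow> upper_cover sig A \<rho> = \<theta>"
  unfolding upper_cover_def by (rule the_equality) (auto simp: is_upper_cover_def)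

lemma is_upper_cover_upper_cover:
  "meet_irreducible sig A \<rho> \<Longrightarrow> is_upper_cover sig A \<rho> (upper_cover sig A \<rho>)"
  unfolding meet_irreducible_def using upper_cover_eq by metis

text \<open>
  \<open>\<theta>/\<rho>\<close> is abelian. In \<open>t(x, y\<^sub>1, y\<^sub>2, \<dots>)\<close> the variable \<open>x\<close> is \<open>0\<close> and \<open>y\<^sub>j\<close> is \<open>j\<close>; the
  parameters are infinite sequences, of which a term uses finitely many entries.
\<close>

definition abelian_over ::
    "('f \<rightharpoonup> nat) \<Rightarrow> ('f, 'a) algebra \<Rightarrow> 'a rel \<Rightarrow> 'a rel \<Rightarrow> bool" where
  "abelian_over sig A \<theta> \<rho> \<longleftrightarrow>
     (\<forall>t a b c d. wf_trm sig t \<longrightarrow> (a, b) \<in> \<theta> \<longrightarrow> (\<forall>j. (c j, d j) \<in> \<theta>) \<longrightarrow>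
        (eval A (case_nat a c) t, eval A (case_nat a d) t) \<in> \<rho> \<longrightarrow>
        (eval A (case_nat b c) t, eval A (case_nat b d) t) \<in> \<rho>)"


section \<open>Bridges\<close>

text \<open>Quadruples \<open>(a\<^sub>1, a\<^sub>2, b\<^sub>1, b\<^sub>2)\<close> are represented as \<open>((a\<^sub>1, a\<^sub>2), (b\<^sub>1, b\<^sub>2))\<close>.\<close>

definition bridge :: "('f \<rightharpoonup> nat) \<Rightarrow> ('f, 'a) algebra \<Rightarrow> 'a rel \<Rightarrow> ('f, 'b) algebra \<Rightarrow> 'b rel
    \<Rightarrow> (('a \<times> 'a) \<times> ('b \<times> 'b)) set \<Rightarrow> bool" where
  "bridge sig A \<rho> B \<sigma> T \<longleftrightarrow>
     \<rho> \<in> Con sig A \<and> \<rho> \<noteq> carrier A \<times> carrier A \<and>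
     \<sigma> \<in> Con sig B \<and> \<sigma> \<noteq> carrier B \<times> carrier B \<and>
     subuniverse sig (prod_alg (prod_alg A A) (prod_alg B B)) T \<and>
     (\<forall>a\<^sub>1 a\<^sub>2 b\<^sub>1 b\<^sub>2 a\<^sub>1' a\<^sub>2' b\<^sub>1' b\<^sub>2'. ((a\<^sub>1, a\<^sub>2), (b\<^sub>1, b\<^sub>2)) \<in> T \<longrightarrow>
        (a\<^sub>1, a\<^sub>1') \<in> \<rho> \<longrightarrow> (a\<^sub>2, a\<^sub>2') \<in> \<rho> \<longrightarrow> (b\<^sub>1, b\<^sub>1') \<in> \<sigma> \<longrightarrow> (b\<^sub>2, b\<^sub>2') \<in> \<sigma> \<longrightarrow>
        ((a\<^sub>1', a\<^sub>2'), (b\<^sub>1', b\<^sub>2')) \<in> T) \<and>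
     \<rho> \<subset> fst ` T \<and> \<sigma> \<subset> snd ` T \<and>
     (\<forall>(p, q)\<in>T. p \<in> \<rho> \<longleftrightarrow> q \<in> \<sigma>)"

definition bridge_between :: "('f \<rightharpoonup> nat) \<Rightarrow> ('f, 'a) algebra \<Rightarrow> 'a rel \<Rightarrow> 'a rel
    \<Rightarrow> ('f, 'b) algebra \<Rightarrow> 'b rel \<Rightarrow> 'b rel \<Rightarrow> (('a \<times> 'a) \<times> ('b \<times> 'b)) set \<Rightarrow> bool" where
  "bridge_between sig A \<rho> L B \<sigma> R T \<longleftrightarrow>
     bridge sig A \<rho> B \<sigma> T \<and> fst ` T = L \<and> snd ` T = R"

definition bridge_trace :: "(('a \<times> 'a) \<times> ('b \<times> 'b)) set \<Rightarrow> ('a \<times> 'b) set" where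
  "bridge_trace T = {(a, b). ((a, a), (b, b)) \<in> T}"

definition saturated :: "'a rel \<Rightarrow> 'a rel \<Rightarrow> bool" where
  "saturated \<rho> R \<longleftrightarrow> R = \<rho> O R O \<rho>"

definition sat_above :: "('f \<rightharpoonup> nat) \<Rightarrow> ('f, 'a) algebra \<Rightarrow> 'a rel \<Rightarrow> 'a rel set" where
  "sat_above sig A \<rho> =
     {R. subuniverse sig (prod_alg A A) R \<and> saturated \<rho> R \<and> \<rho> \<subset> R \<and> R \<subseteq> upper_cover sig A \<rho>}"

definition Cov_plus :: "('f \<rightharpoonup> nat) \<Rightarrow> ('f, 'a) algebra \<Rightarrow> 'a rel \<Rightarrow> 'a rel set" where
  "Cov_plus sig A \<rho> =
     {\<tau> \<in> sat_above sig A \<rho>. \<not> (\<exists>R\<in>sat_above sig A \<rho>. R \<subset> \<tau>)}"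

definition good_bridge :: "('f \<rightharpoonup> nat) \<Rightarrow> ('f, 'a) algebra \<Rightarrow> 'a rel \<Rightarrow> ('f, 'b) algebra
    \<Rightarrow> 'b rel \<Rightarrow> (('a \<times> 'a) \<times> ('b \<times> 'b)) set \<Rightarrow> bool" where
  "good_bridge sig A \<rho> B \<sigma> T \<longleftrightarrow>
     bridge sig A \<rho> B \<sigma> T \<and>
     (\<exists>\<tau>\<in>Cov_plus sig A \<rho>. \<exists>\<tau>'\<in>Cov_plus sig B \<sigma>. \<exists>T'\<subseteq>T.
        bridge_between sig A \<rho> \<tau> B \<sigma> \<tau>' T' \<and> bridge_trace T' = bridge_trace T)"

end

theory Submission imports Defs begin

text \<open>
  Dividing by the congruences, one may take \<open>\<rho>\<close> and \<open>\<sigma>\<close> to be the equality relations; bridges can be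
  reversed, so it suffices to exclude that the monolith \<open>\<mu>\<close> of \<open>A\<close> is nonabelian while that of \<open>B\<close>
  is abelian. A nonabelian \<open>\<mu>\<close> has, inside \<open>fst ` T\<close> up to a swap, a pair \<open>(i, l)\<close>
  with \<open>i \<noteq> l\<close> and a binary polynomial \<open>p\<close> acting on \<open>{i, l}\<close> as the meet operation with \<open>l < i\<close>.
  Since \<open>T\<close> matches the diagonals of both sides, \<open>p\<close> lifts along \<open>T\<close> to a polynomial of the
  algebra \<open>C = snd ` T\<close>, whose first projection kernel \<open>\<eta>\<close> is abelian. Let \<open>\<Psi>\<close> be the largest
  congruence of \<open>C\<close> saturating the diagonal. No pair that is related by the \<open>\<Psi>\<close>-solvable relation
  generated by \<open>\<eta>\<close> and \<open>\<Psi>\<close> can carry a meet operation modulo \<open>\<Psi>\<close>. A lift \<open>r\<close> of \<open>(i, l)\<close>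
  is \<open>\<eta>\<close>-related to a diagonal element, a lift of some \<open>(z, z)\<close>; evaluating \<open>p\<close> there forces
  \<open>z = l\<close>, and then \<open>p\<close> is a meet operation on \<open>r\<close> and this element.
\<close>

section \<open>Polynomial functions\<close>

text \<open>The coordinate functions in \<open>V\<close> play the part of variables, so one, two or
  infinitely many variables share one induction and substitution is precomposition. Members are
  total functions, meaningful where the coordinates land in the carrier.\<close>

inductive_set polys :: "('f \<rightharpoonup> nat) \<Rightarrow> ('f, 'a) algebra \<Rightarrow> ('x \<Rightarrow> 'a) set \<Rightarrow> ('x \<Rightarrow> 'a) set"
  for sig A V where
  var: "v \<in> V \<Longrightarrow> v \<in> polys sig A V"
| const: "a \<in> carrier A \<Longrightarrow> (\<lambda>_. a) \<in> polys sig A V"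
| op: "sig f = Some (length gs) \<Longrightarrow> \<forall>g\<in>set gs. g \<in> polys sig A V \<Longrightarrow>
    (\<lambda>x. opn A f (map (\<lambda>g. g x) gs)) \<in> polys sig A V"

abbreviation pol1 :: "('f \<rightharpoonup> nat) \<Rightarrow> ('f, 'a) algebra \<Rightarrow> ('a \<Rightarrow> 'a) set" where
  "pol1 sig A \<equiv> polys sig A {\<lambda>x. x}"

abbreviation pol2 :: "('f \<rightharpoonup> nat) \<Rightarrow> ('f, 'a) algebra \<Rightarrow> ('a \<times> 'a \<Rightarrow> 'a) set" where
  "pol2 sig A \<equiv> polys sig A {fst, snd}"

lemma subuniverse_opn:
  "subuniverse sig A S \<Longrightarrow> sig f = Some (length xs) \<Longrightarrow> set xs \<subseteq> S \<Longrightarrow> opn A f xs \<in> S"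
  by (simp add: subuniverse_def)

lemma polys_subst:
  assumes "g \<in> polys sig A W" "\<And>w. w \<in> W \<Longrightarrow> (\<lambda>x. w (\<phi> x)) \<in> polys sig A V"
  shows "(\<lambda>x. g (\<phi> x)) \<in> polys sig A V"
  using assms(1)
proof induction
  case (var v)
  then show ?case by (rule assms(2))
next
  case (const a)
  then show ?case by (rule polys.const)
next
  case (op f gs)
  have "(\<lambda>x. opn A f (map (\<lambda>g. g x) (map (\<lambda>g x. g (\<phi> x)) gs))) \<in> polys sig A V"
    by (rule polys.op) (use op in auto)
  then show ?case by (simp add: comp_def)
qed

lemma polys_comp1:
  "f \<in> pol1 sig A \<Longrightarrow> g \<in> polys sig A V \<Longrightarrow> (\<lambda>x. f (g x)) \<in> polys sig A V"
  by (rule polys_subst) auto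

lemma polys_comp2:
  "s \<in> pol2 sig A \<Longrightarrow> g \<in> polys sig A V \<Longrightarrow> h \<in> polys sig A V \<Longrightarrow>
    (\<lambda>x. s (g x, h x)) \<in> polys sig A V"
  by (rule polys_subst[where \<phi> = "\<lambda>x. (g x, h x)"]) auto

lemma pol1_id: "(\<lambda>x. x) \<in> pol1 sig A"
  by (rule polys.var) simp

lemma pol2_fst: "fst \<in> pol2 sig A" and pol2_snd: "snd \<in> pol2 sig A"
  by (auto intro: polys.var)

lemma pol2_left: "s \<in> pol2 sig A \<Longrightarrow> a \<in> carrier A \<Longrightarrow> (\<lambda>x. s (x, a)) \<in> pol1 sig A"
  by (rule polys_comp2) (auto intro: polys.intros)

lemma pol2_right: "s \<in> pol2 sig A \<Longrightarrow> a \<in> carrier A \<Longrightarrow> (\<lambda>x. s (a, x)) \<in> pol1 sig A"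
  by (rule polys_comp2) (auto intro: polys.intros)

lemma pol2_swap: "s \<in> pol2 sig A \<Longrightarrow> (\<lambda>(x, y). s (y, x)) \<in> pol2 sig A"
  using polys_comp2[of s sig A snd "{fst, snd}" fst] by (simp add: pol2_fst pol2_snd case_prod_unfold)

lemma pol1_funpow: "f \<in> pol1 sig A \<Longrightarrow> f ^^ n \<in> pol1 sig A"
proof (induction n)
  case 0
  then show ?case using pol1_id by (simp add: id_def)
next
  case (Suc n)
  then show ?case using polys_comp1[of f sig A "f ^^ n"] by (simp add: comp_def)
qed

lemma pol2_funpow:
  assumes "s \<in> pol2 sig A"
  shows "(\<lambda>p. ((\<lambda>z. s (fst p, z)) ^^ n) (snd p)) \<in> pol2 sig A"
proof (induction n)
  case 0
  then show ?case using pol2_snd by simp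
next
  case (Suc n)
  then show ?case using polys_comp2[OF assms pol2_fst Suc] by simp
qed

text \<open>Constants contribute diagonal pairs, so a compatible relation containing the diagonal is
  stable under polynomials. Besides congruences, \<open>R\<close> will be a projection of a bridge
  or the relation of having a common partner in one.\<close>

lemma polys_rel:
  assumes "subuniverse sig (prod_alg A A) R" "Id_on (carrier A) \<subseteq> R"
    and "g \<in> polys sig A V" "\<And>v. v \<in> V \<Longrightarrow> (v x, v y) \<in> R"
  shows "(g x, g y) \<in> R"
  using assms(3)
proof induction
  case (op f gs)
  have "opn (prod_alg A A) f (map (\<lambda>g. (g x, g y)) gs) \<in> R"
    using assms(1) op unfolding subuniverse_def by (metis (mono_tags, lifting) image_subsetI length_map list.set_map)
  then show ?case by (simp add: prod_alg_def comp_def)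
qed (use assms in auto)

lemma polys_closed:
  assumes "is_algebra sig A" "g \<in> polys sig A V" "\<And>v. v \<in> V \<Longrightarrow> v x \<in> carrier A"
  shows "g x \<in> carrier A"
  using assms(2)
proof induction
  case (op f gs)
  have "opn A f (map (\<lambda>g. g x) gs) \<in> carrier A"
    using assms(1) op unfolding subuniverse_def is_algebra_def
    by (metis (mono_tags, lifting) image_subsetI length_map list.set_map)
  then show ?case .
qed (use assms in auto)

lemma pol1_closed: "is_algebra sig A \<Longrightarrow> f \<in> pol1 sig A \<Longrightarrow> x \<in> carrier A \<Longrightarrow> f x \<in> carrier A"
  by (erule polys_closed) auto

lemma pol2_closed:
  "is_algebra sig A \<Longrightarrow> s \<in> pol2 sig A \<Longrightarrow> x \<in> carrier A \<Longrightarrow> y \<in> carrier A \<Longrightarrow> s (x, y) \<in> carrier A"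
  by (erule polys_closed) auto

lemma ConD:
  assumes "\<theta> \<in> Con sig A"
  shows "\<theta> \<subseteq> carrier A \<times> carrier A" "Id_on (carrier A) \<subseteq> \<theta>" "sym \<theta>" "trans \<theta>"
    "subuniverse sig (prod_alg A A) \<theta>"
  using assms unfolding Con_def equiv_def by (auto simp: subuniverse_def prod_alg_def refl_on_def)

lemma Con_pol1: "\<theta> \<in> Con sig A \<Longrightarrow> f \<in> pol1 sig A \<Longrightarrow> (x, y) \<in> \<theta> \<Longrightarrow> (f x, f y) \<in> \<theta>"
  by (rule polys_rel[where A = A and sig = sig]) (auto dest: ConD)

text \<open>Changing the arguments of an operation one at a time uses only unary polynomials.\<close>

lemma ConI_pol1:
  assumes alg: "is_algebra sig A" and eq: "equiv (carrier A) \<theta>" and sub: "\<theta> \<subseteq> carrier A \<times> carrier A"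
    and cl: "\<And>f x y. f \<in> pol1 sig A \<Longrightarrow> (x, y) \<in> \<theta> \<Longrightarrow> (f x, f y) \<in> \<theta>"
  shows "\<theta> \<in> Con sig A"
proof -
  have *: "(opn A f (pre @ us), opn A f (pre @ vs)) \<in> \<theta>"
    if "list_all2 (\<lambda>u v. (u, v) \<in> \<theta>) us vs" "sig f = Some (length (pre @ us))" "set pre \<subseteq> carrier A"
    for f pre us vs
    using that
  proof (induction us vs arbitrary: pre rule: list_all2_induct)
    case Nil
    then have "opn A f pre \<in> carrier A"
      using alg by (auto simp: is_algebra_def subuniverse_def)
    then show ?case using eq by (auto simp: equiv_def refl_on_def)
  next
    case (Cons u us v vs)
    have uv: "u \<in> carrier A" "v \<in> carrier A" using Cons.hyps(1) sub by auto
    have us: "set us \<subseteq> carrier A"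
      using Cons.hyps(2) sub by (induction rule: list_all2_induct) auto
    let ?gs = "map (\<lambda>a _. a) pre @ (\<lambda>x. x) # map (\<lambda>a _. a) us"
    have "(\<lambda>x. opn A f (map (\<lambda>g. g x) ?gs)) \<in> pol1 sig A"
      by (rule polys.op) (use Cons.prems us in \<open>auto intro: polys.intros\<close>)
    from cl[OF this Cons.hyps(1)]
    have "(opn A f (pre @ u # us), opn A f (pre @ v # us)) \<in> \<theta>"
      by (simp add: comp_def)
    moreover have "(opn A f ((pre @ [v]) @ us), opn A f ((pre @ [v]) @ vs)) \<in> \<theta>"
      by (rule Cons.IH) (use Cons.prems uv in auto)
    ultimately show ?case using eq by (auto simp: equiv_def dest: transD)
  qed
  have "subuniverse sig (prod_alg A A) \<theta>"
    unfolding subuniverse_def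
  proof (intro conjI allI impI)
    show "\<theta> \<subseteq> carrier (prod_alg A A)" using sub by (simp add: prod_alg_def)
    fix f xs assume "sig f = Some (length xs)" "set xs \<subseteq> \<theta>"
    moreover from this(2) have "list_all2 (\<lambda>u v. (u, v) \<in> \<theta>) (map fst xs) (map snd xs)"
      by (induction xs) auto
    ultimately show "opn (prod_alg A A) f xs \<in> \<theta>"
      using *[of "map fst xs" "map snd xs" f "[]"] by (simp add: prod_alg_def)
  qed
  then show ?thesis using eq by (simp add: Con_def)
qed

text \<open>Precomposition with unary polynomials stays within the family, so its common kernel is
  stable under them. All congruences below that are defined by a test over polynomials arise this
  way; the values of \<open>F\<close> are elements, truth values or optional pairs.\<close>

lemma ConI_kernel:
  assumes "is_algebra sig A"
    and "\<And>i f. i \<in> I \<Longrightarrow> f \<in> pol1 sig A \<Longrightarrow> \<exists>j\<in>I. \<forall>a\<in>carrier A. F j a = F i (f a)"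
  shows "{(a, b) \<in> carrier A \<times> carrier A. \<forall>i\<in>I. F i a = F i b} \<in> Con sig A"
proof (rule ConI_pol1[OF assms(1)])
  show "equiv (carrier A) {(a, b) \<in> carrier A \<times> carrier A. \<forall>i\<in>I. F i a = F i b}"
    by (auto simp: equiv_def refl_on_def sym_def trans_def)
next
  fix f x y assume f: "f \<in> pol1 sig A"
    and "(x, y) \<in> {(a, b) \<in> carrier A \<times> carrier A. \<forall>i\<in>I. F i a = F i b}"
  then have xy: "x \<in> carrier A" "y \<in> carrier A" "\<And>i. i \<in> I \<Longrightarrow> F i x = F i y" by auto
  have "F i (f x) = F i (f y)" if "i \<in> I" for i
    using assms(2)[OF that f] xy by metis
  then show "(f x, f y) \<in> {(a, b) \<in> carrier A \<times> carrier A. \<forall>i\<in>I. F i a = F i b}"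
    using xy f pol1_closed[OF assms(1)] by auto
qed auto

section \<open>Iterating self-maps of finite sets\<close>

lemma funpow_in: "f ` S \<subseteq> S \<Longrightarrow> x \<in> S \<Longrightarrow> (f ^^ n) x \<in> S"
  by (induction n) auto

text \<open>The exponent does not depend on \<open>f\<close>. Later the same power of
  \<open>q (w, _)\<close> and \<open>q (w', _)\<close> has to come from one binary
  polynomial.\<close>

lemma idempotent_power:
  assumes "finite S"
  obtains K where "K > 0" "\<And>f x. f ` S \<subseteq> S \<Longrightarrow> x \<in> S \<Longrightarrow> (f ^^ K) ((f ^^ K) x) = (f ^^ K) x"
proof
  \<comment> \<open>The factorial is a multiple of every period up to \<open>card S\<close> and at
    least every preperiod, so it fits all self-maps at once.\<close>
  let ?n = "card S" and ?K = "fact (card S) :: nat"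
  show "?K > 0" by simp
  fix f x assume f: "f ` S \<subseteq> S" and x: "x \<in> S"
  have "\<not> inj_on (\<lambda>i. (f ^^ i) x) {..?n}"
  proof
    assume "inj_on (\<lambda>i. (f ^^ i) x) {..?n}"
    then have "card ((\<lambda>i. (f ^^ i) x) ` {..?n}) = Suc ?n" by (simp add: card_image)
    moreover have "card ((\<lambda>i. (f ^^ i) x) ` {..?n}) \<le> ?n"
      using assms f x by (intro card_mono) (auto intro: funpow_in)
    ultimately show False by simp
  qed
  then obtain i j where ij: "i < j" "j \<le> ?n" "(f ^^ i) x = (f ^^ j) x"
    unfolding inj_on_def by (metis atMost_iff linorder_neqE_nat)
  have per: "(f ^^ (i + k * (j - i))) x = (f ^^ i) x" for k
  proof (induction k)
    case (Suc k)
    have "i + Suc k * (j - i) = (j - i) + (i + k * (j - i))" by simp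
    then have "(f ^^ (i + Suc k * (j - i))) x = (f ^^ (j - i)) ((f ^^ (i + k * (j - i))) x)"
      by (simp only: funpow_add comp_apply)
    also have "\<dots> = (f ^^ ((j - i) + i)) x" unfolding Suc by (simp add: funpow_add)
    also have "\<dots> = (f ^^ i) x" using ij by simp
    finally show ?case .
  qed simp
  have "(j - i) dvd ?K" by (rule dvd_fact) (use ij in auto)
  then obtain k where k: "?K = k * (j - i)" by (metis dvd_def mult.commute)
  have iK: "i \<le> ?K" using ij fact_ge_self[of ?n] by linarith
  have "?K + ?K = (?K - i) + (i + k * (j - i))" using iK k by linarith
  then have "(f ^^ (?K + ?K)) x = (f ^^ (?K - i)) ((f ^^ (i + k * (j - i))) x)"
    by (simp only: funpow_add comp_apply)
  also have "\<dots> = (f ^^ ((?K - i) + i)) x" unfolding per by (simp add: funpow_add)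
  also have "\<dots> = (f ^^ ?K) x" using iK by simp
  finally show "(f ^^ ?K) ((f ^^ ?K) x) = (f ^^ ?K) x" by (simp add: funpow_add)
qed

lemma inj_on_funpow:
  "f ` S \<subseteq> S \<Longrightarrow> inj_on f S \<Longrightarrow> inj_on (f ^^ n) S"
proof (induction n)
  case (Suc n)
  then show ?case by (auto simp: inj_on_def funpow_in)
qed simp

text \<open>An idempotent power of an injective map is the identity. The exponent is written
  \<open>Suc m\<close> so that \<open>f ^^ m\<close> inverts \<open>f\<close> on \<open>S\<close>;
  polynomial permutations are inverted this way below.\<close>

lemma injective_power:
  assumes "finite S"
  obtains m where "\<And>f x. f ` S \<subseteq> S \<Longrightarrow> inj_on f S \<Longrightarrow> x \<in> S \<Longrightarrow> (f ^^ Suc m) x = x"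
proof -
  obtain K where K: "K > 0" "\<And>f x. f ` S \<subseteq> S \<Longrightarrow> x \<in> S \<Longrightarrow> (f ^^ K) ((f ^^ K) x) = (f ^^ K) x"
    using idempotent_power[OF assms] by blast
  then obtain m where "K = Suc m" using gr0_implies_Suc by blast
  moreover have "(f ^^ K) x = x" if "f ` S \<subseteq> S" "inj_on f S" "x \<in> S" for f x
    using inj_on_funpow[OF that(1,2), of K] K(2)[OF that(1,3)] that funpow_in[OF that(1,3)]
    by (meson inj_onD)
  ultimately show ?thesis using that by blast
qed

section \<open>Minimal sets of a monolith\<close>

locale monolith =
  fixes sig :: "'f \<rightharpoonup> nat" and A :: "('f, 'a) algebra" and \<mu> :: "'a rel"
  assumes alg: "is_algebra sig A" and fin: "finite (carrier A)" and con: "\<mu> \<in> Con sig A"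
    and least: "\<And>\<theta>. \<theta> \<in> Con sig A \<Longrightarrow> \<theta> \<noteq> Id_on (carrier A) \<Longrightarrow> \<mu> \<subseteq> \<theta>"
begin

lemma mu_carrier: "(x, y) \<in> \<mu> \<Longrightarrow> x \<in> carrier A \<and> y \<in> carrier A"
  using ConD(1)[OF con] by auto

text \<open>The common kernel is a congruence containing a pair of distinct elements, so it contains
  \<mu>. An invariant that passes to precomposed polynomials thus has to be checked at one pair
  only.\<close>

lemma least_kernel:
  assumes "\<And>i f. i \<in> I \<Longrightarrow> f \<in> pol1 sig A \<Longrightarrow> \<exists>j\<in>I. \<forall>a\<in>carrier A. F j a = F i (f a)"
    and xy: "x \<in> carrier A" "y \<in> carrier A" "x \<noteq> y" "\<And>i. i \<in> I \<Longrightarrow> F i x = F i y"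
    and "(a, b) \<in> \<mu>" "i \<in> I"
  shows "F i a = F i b"
proof -
  let ?\<theta> = "{(a, b) \<in> carrier A \<times> carrier A. \<forall>i\<in>I. F i a = F i b}"
  have "?\<theta> \<in> Con sig A" by (rule ConI_kernel[OF alg assms(1)])
  moreover have "(x, y) \<in> ?\<theta>" using xy by auto
  then have "?\<theta> \<noteq> Id_on (carrier A)" using xy(3) by (metis Id_onE Pair_inject)
  ultimately have "\<mu> \<subseteq> ?\<theta>" by (rule least)
  then show ?thesis using assms(6,7) by auto
qed

text \<open>If every \<open>f\<close> failed, the kernel of the maps \<open>h \<circ> f\<close>
  would contain \<open>(x, y)\<close>, hence \<mu>; the identity in place of \<open>f\<close> then
  contradicts \<open>h u \<noteq> h v\<close>.\<close>

lemma separating_polynomial: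
  assumes "(u, v) \<in> \<mu>" "h u \<noteq> h v" "x \<in> carrier A" "y \<in> carrier A" "x \<noteq> y"
  obtains f where "f \<in> pol1 sig A" "h (f x) \<noteq> h (f y)"
proof (rule ccontr)
  assume "\<not> thesis"
  then have "h (f x) = h (f y)" if "f \<in> pol1 sig A" for f
    using that \<open>\<And>f. f \<in> pol1 sig A \<Longrightarrow> h (f x) \<noteq> h (f y) \<Longrightarrow> thesis\<close> by blast
  moreover have "\<exists>j\<in>pol1 sig A. \<forall>a\<in>carrier A. h (j a) = h (i (f a))"
    if "i \<in> pol1 sig A" "f \<in> pol1 sig A" for i f
    by (intro bexI[OF _ polys_comp1[OF that]]) simp
  ultimately have "h ((\<lambda>x. x) u) = h ((\<lambda>x. x) v)"
    by (intro least_kernel[where F = "\<lambda>f a. h (f a)", OF _ assms(3-5) _ assms(1) pol1_id])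
  then show False using assms(2) by simp
qed

end

text \<open>The range of \<open>e\<close> is a \<mu>-minimal set of tame congruence theory, picked
  by least cardinality among the ranges of unary polynomials that do not collapse \<mu>;
  \<open>x\<^sub>0\<close> and \<open>y\<^sub>0\<close> lie in one trace of it.\<close>

locale minimal_set = monolith sig A \<mu>
  for sig :: "'f \<rightharpoonup> nat" and A :: "('f, 'a) algebra" and \<mu> :: "'a rel" +
  fixes e :: "'a \<Rightarrow> 'a" and x\<^sub>0 y\<^sub>0 :: 'a
  assumes e: "e \<in> pol1 sig A" and idem: "\<And>x. x \<in> carrier A \<Longrightarrow> e (e x) = e x"
    and xy: "(x\<^sub>0, y\<^sub>0) \<in> \<mu>" "x\<^sub>0 \<noteq> y\<^sub>0" "e x\<^sub>0 = x\<^sub>0" "e y\<^sub>0 = y\<^sub>0"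
    and minimal: "\<And>f x y. f \<in> pol1 sig A \<Longrightarrow> (x, y) \<in> \<mu> \<Longrightarrow> f x \<noteq> f y \<Longrightarrow>
      card (e ` carrier A) \<le> card (f ` carrier A)"

text \<open>The pair is wanted in \<tau> and not merely in \<mu>, since \<tau> will be a projection
  of the bridge. As \<tau> contains the diagonal, polynomials preserve it and can carry one of its
  pairs into the minimal set.\<close>

lemma (in monolith) obtain_minimal_set:
  assumes \<tau>: "subuniverse sig (prod_alg A A) \<tau>" "Id_on (carrier A) \<subset> \<tau>" "\<tau> \<subseteq> \<mu>"
  obtains e x\<^sub>0 y\<^sub>0 where "minimal_set sig A \<mu> e x\<^sub>0 y\<^sub>0" "(x\<^sub>0, y\<^sub>0) \<in> \<tau>"
proof -
  let ?C = "carrier A"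
  obtain x1 y1 where xy1: "(x1, y1) \<in> \<tau>" "(x1, y1) \<notin> Id_on ?C" using \<tau>(2) by auto
  then have xy1': "x1 \<in> ?C" "y1 \<in> ?C" "x1 \<noteq> y1" using mu_carrier \<tau>(3) by auto
  define P where "P h \<longleftrightarrow> h \<in> pol1 sig A \<and> (\<exists>x y. (x, y) \<in> \<mu> \<and> h x \<noteq> h y)" for h
  have "P (\<lambda>x. x)" unfolding P_def using xy1 xy1' \<tau>(3) pol1_id by blast
  then obtain h where h: "P h" "\<And>g. P g \<Longrightarrow> card (h ` ?C) \<le> card (g ` ?C)"
    using ex_has_least_nat[of P "\<lambda>x. x" "\<lambda>h. card (h ` ?C)"] by blast
  obtain x y where hxy: "h \<in> pol1 sig A" "(x, y) \<in> \<mu>" "h x \<noteq> h y" using h(1) by (auto simp: P_def)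
  have hC: "h z \<in> ?C" if "z \<in> ?C" for z using pol1_closed[OF alg hxy(1) that] .
  \<comment> \<open>\<open>h \<circ> f \<circ> h\<close> still separates a \<mu>-pair, so by
    minimality \<open>h \<circ> f\<close> permutes the range of \<open>h\<close>; a power of it is
    the idempotent \<open>e\<close> with the same range.\<close>
  obtain f where f: "f \<in> pol1 sig A" "h (f (h x)) \<noteq> h (f (h y))"
    using separating_polynomial[OF hxy(2), of h "h x" "h y"] hxy hC mu_carrier by metis
  have fC: "f z \<in> ?C" if "z \<in> ?C" for z using pol1_closed[OF alg f(1) that] .
  let ?U = "h ` ?C" and ?hf = "\<lambda>z. h (f z)"
  have U: "?U \<subseteq> ?C" "finite ?U" using hC fin by auto
  have hf: "?hf \<in> pol1 sig A" "?hf ` ?C \<subseteq> ?U"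
    using polys_comp1[OF hxy(1) f(1)] fC by auto
  have "P (\<lambda>z. ?hf (h z))"
    unfolding P_def using polys_comp1[OF hf(1) hxy(1)] f(2) hxy(2) by blast
  then have "card ?U \<le> card (?hf ` ?U)" using h(2) by (metis image_image)
  then have inj: "inj_on ?hf ?U" using U(2) by (simp add: card_image_le eq_card_imp_inj_on le_antisym)
  obtain m where m: "\<And>g x. g ` ?U \<subseteq> ?U \<Longrightarrow> inj_on g ?U \<Longrightarrow> x \<in> ?U \<Longrightarrow> (g ^^ Suc m) x = x"
    using injective_power[OF U(2)] by blast
  define e where "e = ?hf ^^ Suc m"
  have e: "e \<in> pol1 sig A" unfolding e_def by (rule pol1_funpow[OF hf(1)])
  have "(?hf ^^ m) z \<in> ?C" if "z \<in> ?C" for z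
    by (rule funpow_in[OF _ that]) (use hf(2) U(1) in auto)
  then have eU: "e z \<in> ?U" if "z \<in> ?C" for z unfolding e_def using hf(2) that by auto
  have eid: "e z = z" if "z \<in> ?U" for z unfolding e_def
    by (rule m[OF _ inj that]) (use hf(2) U(1) in blast)
  have eC: "e ` ?C = ?U"
  proof
    show "e ` ?C \<subseteq> ?U" using eU by auto
    show "?U \<subseteq> e ` ?C" using eid U(1) by (metis image_eqI subset_iff)
  qed
  \<comment> \<open>\<open>e\<close> fixes \<open>h x\<close> and \<open>h y\<close>, so it
    separates a \<mu>-pair; hence some polynomial moves the chosen \<tau>-pair to one that
    \<open>e\<close> separates.\<close>
  obtain g where g: "g \<in> pol1 sig A" "e (g x1) \<noteq> e (g y1)"
    using separating_polynomial[of "h x" "h y" e x1 y1] Con_pol1[OF con hxy(1,2)] xy1' hxy eid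
      mu_carrier by (metis imageI)
  let ?x = "e (g x1)" and ?y = "e (g y1)"
  have "(?x, ?y) \<in> \<tau>"
    using polys_rel[OF \<tau>(1) _ polys_comp1[OF e g(1)]] \<tau>(2) xy1(1) by simp
  moreover have "minimal_set sig A \<mu> e ?x ?y"
  proof (unfold_locales)
    show "e \<in> pol1 sig A" by (rule e)
    show "e (e z) = e z" if "z \<in> ?C" for z using eU eid that by auto
    show "(?x, ?y) \<in> \<mu>" using \<open>(?x, ?y) \<in> \<tau>\<close> \<tau>(3) by auto
    show "?x \<noteq> ?y" by (rule g(2))
    show "e ?x = ?x" "e ?y = ?y" using eid eU xy1' pol1_closed[OF alg g(1)] by auto
    show "card (e ` ?C) \<le> card (f ` ?C)" if "f \<in> pol1 sig A" "(x, y) \<in> \<mu>" "f x \<noteq> f y" for f x y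
      unfolding eC using h(2) that unfolding P_def by blast
  qed
  ultimately show thesis using that by blast
qed

section \<open>Polynomials on a minimal set: dichotomy and pseudo-meets\<close>

context minimal_set
begin

abbreviation "U \<equiv> e ` carrier A"

lemma finU: "finite U" and U_sub: "U \<subseteq> carrier A"
  using fin pol1_closed[OF alg e] by auto

lemma eU: "x \<in> U \<Longrightarrow> e x = x"
  using idem by auto

lemma xyC: "x\<^sub>0 \<in> carrier A" "y\<^sub>0 \<in> carrier A"
  using mu_carrier[OF xy(1)] by auto

lemma xyU: "x\<^sub>0 \<in> U" "y\<^sub>0 \<in> U"
  using imageI[OF xyC(1), of e] imageI[OF xyC(2), of e] xy(3,4) by simp_all

text \<open>\<open>e \<circ> f \<circ> e\<close> does not collapse \<mu>, so by minimality its range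
  is no smaller than \<open>U\<close>. That range is the image of \<open>U\<close> under
  \<open>e \<circ> f\<close>, and finiteness gives injectivity.\<close>

lemma dichotomy:
  assumes "f \<in> pol1 sig A" "(x, y) \<in> \<mu>" "x \<in> U" "y \<in> U" "e (f x) \<noteq> e (f y)"
  shows "inj_on (\<lambda>x. e (f x)) U"
proof -
  have "(\<lambda>x. e (f (e x))) \<in> pol1 sig A" 
    by (intro polys_comp1[OF e] polys_comp1[OF assms(1)] e)
  then have "card U \<le> card ((\<lambda>x. e (f (e x))) ` carrier A)"
    by (rule minimal[OF _ assms(2)]) 
      (simp_all only: eU[OF assms(3)] eU[OF assms(4)] assms(5) not_False_eq_True)
  also have "(\<lambda>x. e (f (e x))) ` carrier A = (\<lambda>x. e (f x)) ` U" by auto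
  finally show ?thesis using finU by (simp add: card_image_le eq_card_imp_inj_on le_antisym)
qed

lemma pol2_dichotomy:
  assumes "s \<in> pol2 sig A" "c \<in> carrier A" "(x, y) \<in> \<mu>" "x \<in> U" "y \<in> U"
    "e (s (x, c)) \<noteq> e (s (y, c))"
  shows "inj_on (\<lambda>x. e (s (x, c))) U"
  using dichotomy[OF pol2_left[OF assms(1,2)] assms(3-6)] .

lemma eU_maps: "f \<in> pol1 sig A \<Longrightarrow> (\<lambda>x. e (f x)) ` U \<subseteq> U"
  using pol1_closed[OF alg] U_sub by auto

text \<open>
  This is the part of Palfy's theorem on minimal algebras that yields a pseudo-meet: the trace
  has just two elements, and iterating \<open>s\<close> in either variable gives the semilattice operation.
\<close>

lemma pseudo_meet_of_mixed_twins:
  assumes s: "s \<in> pol2 sig A" and ab: "{a, b} = {x\<^sub>0, y\<^sub>0}"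
    and a: "e (s (x\<^sub>0, a)) \<noteq> e (s (y\<^sub>0, a))" and b: "e (s (x\<^sub>0, b)) = e (s (y\<^sub>0, b))"
  obtains p z\<^sub>1 z\<^sub>0 where "p \<in> pol2 sig A" "{z\<^sub>1, z\<^sub>0} = {x\<^sub>0, y\<^sub>0}"
    "p (z\<^sub>1, z\<^sub>1) = z\<^sub>1" "p (z\<^sub>1, z\<^sub>0) = z\<^sub>0" "p (z\<^sub>0, z\<^sub>1) = z\<^sub>0" "p (z\<^sub>0, z\<^sub>0) = z\<^sub>0"
proof -
  obtain m where m: "\<And>g x. g ` U \<subseteq> U \<Longrightarrow> inj_on g U \<Longrightarrow> x \<in> U \<Longrightarrow> (g ^^ Suc m) x = x"
    using injective_power[OF finU] by blast
  have sym: "(y, x) \<in> \<mu>" if "(x, y) \<in> \<mu>" for x y using ConD(3)[OF con] that by (auto dest: symD)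
  have tr: "(x, z) \<in> \<mu>" if "(x, y) \<in> \<mu>" "(y, z) \<in> \<mu>" for x y z
    using ConD(4)[OF con] that by (auto dest: transD)
  have rf: "(x, x) \<in> \<mu>" if "x \<in> carrier A" for x using ConD(2)[OF con] that by auto
  have "{a, b} \<subseteq> U \<inter> carrier A" unfolding ab using xyU xyC by blast
  then have abU: "a \<in> U" "b \<in> U" and abC: "a \<in> carrier A" "b \<in> carrier A" by blast+
  have abm: "(a, b) \<in> \<mu>" using ab xy(1) sym rf xyC by (auto simp: doubleton_eq_iff)
  have "a \<noteq> b" using a b by auto
  define q where "q = (\<lambda>x. e (s (x, a)))"
  have sa: "(\<lambda>x. s (x, a)) \<in> pol1 sig A" by (rule pol2_left[OF s abC(1)])
  have q: "q \<in> pol1 sig A" unfolding q_def by (rule polys_comp1[OF e sa])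
  have qU: "q ` U \<subseteq> U" unfolding q_def by (rule eU_maps[OF sa])
  have qinj: "inj_on q U" unfolding q_def by (rule dichotomy[OF sa xy(1) xyU a])
  have qm: "(q ^^ m) (q x) = x" if "x \<in> U" for x
    using m[OF qU qinj that] by (simp add: funpow_swap1)
  \<comment> \<open>Undoing the permutation \<open>q\<close> makes \<open>a\<close> a right unit on
    \<open>U\<close>, while \<open>b\<close> still identifies \<open>x\<^sub>0\<close> with
    \<open>y\<^sub>0\<close>.\<close>
  define s' where "s' p = (q ^^ m) (e (s p))" for p
  have s': "s' \<in> pol2 sig A" unfolding s'_def
    by (intro polys_comp1[OF pol1_funpow[OF q]] polys_comp1[OF e] s)
  have s'U: "s' (x, y) \<in> U" if "x \<in> carrier A" "y \<in> carrier A" for x y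
    unfolding s'_def using funpow_in[OF qU] pol2_closed[OF alg s that] by auto
  have s'a: "s' (x, a) = x" if "x \<in> U" for x using qm[OF that] by (simp add: s'_def q_def)
  have s'm: "(s' (x, y), s' (x', y')) \<in> \<mu>" if "(x, x') \<in> \<mu>" "(y, y') \<in> \<mu>" for x x' y y'
    by (rule polys_rel[OF ConD(5)[OF con] ConD(2)[OF con] s']) (use that in auto)
  \<comment> \<open>The trace: the part of the \<mu>-class of \<open>a\<close> that lies in the
    minimal set.\<close>
  define N where "N = {x \<in> U. (x, a) \<in> \<mu>}"
  have N: "x\<^sub>0 \<in> N" "y\<^sub>0 \<in> N" "a \<in> N" "b \<in> N" "N \<subseteq> U" unfolding N_def
    using ab abm xyU abU sym rf abC by (auto simp: doubleton_eq_iff)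
  have NN: "(x, y) \<in> \<mu>" if "x \<in> N" "y \<in> N" for x y using that tr sym unfolding N_def by blast
  have NC: "x \<in> carrier A" if "x \<in> N" for x using that N(5) U_sub by blast
  have dich2: "inj_on (\<lambda>z. t (z, c)) U"
    if "t \<in> pol2 sig A" "\<And>x y. x \<in> carrier A \<Longrightarrow> y \<in> carrier A \<Longrightarrow> t (x, y) \<in> U"
      "c \<in> carrier A" "x \<in> N" "y \<in> N" "t (x, c) \<noteq> t (y, c)" for t c x y
  proof -
    have et: "e (t (z, c)) = t (z, c)" if "z \<in> U" for z using that U_sub \<open>c \<in> carrier A\<close>
      by (intro eU that) (use \<open>\<And>x y. x \<in> carrier A \<Longrightarrow> y \<in> carrier A \<Longrightarrow> t (x, y) \<in> U\<close> in auto)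
    have xyU': "x \<in> U" "y \<in> U" using that(4,5) N(5) by blast+
    have "e (t (x, c)) \<noteq> e (t (y, c))" unfolding et[OF xyU'(1)] et[OF xyU'(2)] by (rule that(6))
    then have "inj_on (\<lambda>z. e (t (z, c))) U"
      by (rule pol2_dichotomy[OF that(1,3) NN[OF that(4,5)] xyU'])
    then show ?thesis using et by (simp add: inj_on_def)
  qed
  \<comment> \<open>Since \<open>s' (_, b)\<close> is not injective, the dichotomy makes it constant
    on the trace; its value \<open>k\<close> will be the zero of the meet.\<close>
  define k where "k = s' (x\<^sub>0, b)"
  have s'b: "s' (x, b) = k" if "x \<in> N" for x
  proof (rule ccontr)
    assume "s' (x, b) \<noteq> k"
    then have "inj_on (\<lambda>z. s' (z, b)) U"
      using dich2[OF s' s'U abC(2) that N(1)] by (simp add: k_def)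
    moreover have "s' (x\<^sub>0, b) = s' (y\<^sub>0, b)" using b by (simp add: s'_def)
    ultimately show False using xy(2) xyU by (meson inj_onD)
  qed
  have kU: "k \<in> U" unfolding k_def by (rule s'U[OF xyC(1) abC(2)])
  have "(k, x\<^sub>0) \<in> \<mu>" using s'm[OF rf[OF xyC(1)] sym[OF abm]] s'a[OF xyU(1)] by (simp add: k_def)
  then have kN: "k \<in> N" unfolding N_def using kU tr NN N by blast
  have s'sw: "(\<lambda>(x, y). s' (y, x)) \<in> pol2 sig A" by (rule pol2_swap[OF s'])
  \<comment> \<open>A second value would make \<open>s' (k, _)\<close> injective by the dichotomy,
    yet it equals \<open>k\<close> at both \<open>a\<close> and \<open>b\<close>. For other
    \<open>x\<close> in the trace, the row takes the distinct values \<open>x\<close> at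
    \<open>a\<close> and \<open>k\<close> at \<open>b\<close>, so it is injective.\<close>
  have s'k: "s' (k, y) = k" if "y \<in> N" for y
  proof (rule ccontr)
    assume "s' (k, y) \<noteq> k"
    then have "inj_on (\<lambda>z. (\<lambda>(x, y). s' (y, x)) (z, k)) U"
      by (intro dich2[OF s'sw _ NC[OF kN] that N(4)]) (use s'b[OF kN] s'U in auto)
    then have "inj_on (\<lambda>z. s' (k, z)) U" by simp
    from inj_onD[OF this _ abU] show False using s'b[OF kN] s'a[OF kU] \<open>a \<noteq> b\<close> by simp
  qed
  have s'inj: "inj_on (\<lambda>y. s' (x, y)) U" if "x \<in> N" "x \<noteq> k" for x
  proof -
    have "inj_on (\<lambda>z. (\<lambda>(x, y). s' (y, x)) (z, x)) U"
      by (rule dich2[OF s'sw _ NC[OF that(1)] N(3) N(4)])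
        (use s'b[OF that(1)] s'a[of x] that N(5) s'U in auto)
    then show ?thesis by simp
  qed
  \<comment> \<open>Iteration in the second variable turns the injective rows into the identity on
    \<open>U\<close> and keeps the row of \<open>k\<close> constant on the trace.\<close>
  define p where "p w = ((\<lambda>z. s' (fst w, z)) ^^ Suc m) (snd w)" for w
  have p: "p \<in> pol2 sig A" unfolding p_def by (rule pol2_funpow[OF s'])
  have p1: "p (x, y) = y" if "x \<in> N" "x \<noteq> k" "y \<in> U" for x y
    unfolding p_def fst_conv snd_conv
    by (rule m[OF _ s'inj[OF that(1,2)] that(3)]) (use s'U NC[OF that(1)] U_sub in auto)
  have p0: "p (k, y) = k" if "y \<in> N" for y
  proof -
    have "((\<lambda>z. s' (k, z)) ^^ n) y \<in> N \<and> (n > 0 \<longrightarrow> ((\<lambda>z. s' (k, z)) ^^ n) y = k)" for n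
      by (induction n) (use that s'k kN in auto)
    then show ?thesis unfolding p_def by (metis fst_conv snd_conv zero_less_Suc)
  qed
  have pU: "p (x, y) \<in> U" if "x \<in> carrier A" "y \<in> carrier A" for x y
  proof -
    have "((\<lambda>z. s' (x, z)) ^^ m) y \<in> carrier A"
      by (rule funpow_in) (use s'U U_sub that in auto)
    then show ?thesis unfolding p_def using s'U that by simp
  qed
  \<comment> \<open>Otherwise \<open>p (_, x\<^sub>0)\<close> sends both \<open>x\<^sub>0\<close>
    and \<open>y\<^sub>0\<close> to \<open>x\<^sub>0\<close> but fixes \<open>k\<close>, against the
    dichotomy.\<close>
  have k: "k \<in> {x\<^sub>0, y\<^sub>0}"
  proof (rule ccontr)
    assume *: "k \<notin> {x\<^sub>0, y\<^sub>0}"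
    then have "inj_on (\<lambda>z. p (z, x\<^sub>0)) U"
      by (intro dich2[OF p pU xyC(1) kN N(1)]) (use p0 p1 N xyU in auto)
    moreover have "p (x\<^sub>0, x\<^sub>0) = p (y\<^sub>0, x\<^sub>0)" using * p1 N xyU by auto
    ultimately show False using xy(2) xyU by (auto dest: inj_onD)
  qed
  define l where "l = (if k = x\<^sub>0 then y\<^sub>0 else x\<^sub>0)"
  have l: "{l, k} = {x\<^sub>0, y\<^sub>0}" "l \<noteq> k" "l \<in> N" using k xy(2) N by (auto simp: l_def)
  show thesis
    by (rule that[OF p l(1)]) (use p0 p1 l kN kU N(5) in auto)
qed

end

section \<open>Polynomials in one variable and a sequence of parameters\<close>

abbreviation mpol :: "('f \<rightharpoonup> nat) \<Rightarrow> ('f, 'a) algebra \<Rightarrow> ('a \<times> (nat \<Rightarrow> 'a) \<Rightarrow> 'a) set" where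
  "mpol sig A \<equiv> polys sig A (insert fst (range (\<lambda>j p. snd p j)))"

lemma mpol_finite_dependence:
  assumes "t \<in> mpol sig A"
  obtains n where "\<And>x v w. \<forall>j<n. v j = w j \<Longrightarrow> t (x, v) = t (x, w)"
proof -
  have "\<exists>n. \<forall>x v w. (\<forall>j<n. v j = w j) \<longrightarrow> t (x, v) = t (x, w)" using assms
  proof induction
    case (var g)
    then consider "g = fst" | j where "g = (\<lambda>p. snd p j)" by auto
    then show ?case
    proof cases
      case 2
      then have "\<forall>x v w. (\<forall>i<Suc j. v i = w i) \<longrightarrow> g (x, v) = g (x, w)" by simp
      then show ?thesis by blast
    qed simp
  next
    case (op f gs)
    then have "\<forall>g\<in>set gs. \<exists>n. \<forall>x v w. (\<forall>j<n. v j = w j) \<longrightarrow> g (x, v) = g (x, w)" by auto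
    then obtain N where
      N: "g \<in> set gs \<Longrightarrow> \<forall>j<N g. v j = w j \<Longrightarrow> g (x, v) = g (x, w)" for g x v w by metis
    let ?n = "Max (insert 0 (N ` set gs))"
    have le: "N g \<le> ?n" if "g \<in> set gs" for g using that by (intro Max_ge) auto
    have eq: "g (x, v) = g (x, w)" if "g \<in> set gs" "\<forall>j<?n. v j = w j" for g x v w
    proof (rule N[OF that(1)], intro allI impI)
      fix j assume "j < N g"
      then have "j < ?n" using le[OF that(1)] by (rule order_less_le_trans)
      then show "v j = w j" using that(2) by blast
    qed
    have "map (\<lambda>g. g (x, v)) gs = map (\<lambda>g. g (x, w)) gs" if "\<forall>j<?n. v j = w j" for x v w
      by (rule map_cong[OF refl eq[OF _ that]])
    then show ?case by (intro exI[of _ ?n] allI impI arg_cong[where f = "opn A f"])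
  qed simp
  then show thesis using that by metis
qed

lemma mpol_closed:
  "is_algebra sig A \<Longrightarrow> t \<in> mpol sig A \<Longrightarrow> x \<in> carrier A \<Longrightarrow> \<forall>j. v j \<in> carrier A \<Longrightarrow> t (x, v) \<in> carrier A"
  by (erule polys_closed) auto

text \<open>Freezing all parameters but one makes results on binary polynomials available for each
  single exchange of a parameter.\<close>

lemma mpol_update:
  assumes "t \<in> mpol sig A" "\<forall>i. v i \<in> carrier A"
  shows "(\<lambda>p. t (fst p, v(j := snd p))) \<in> pol2 sig A"
proof (rule polys_subst[OF assms(1)])
  fix w :: "'a \<times> (nat \<Rightarrow> 'a) \<Rightarrow> 'a"
  assume "w \<in> insert fst (range (\<lambda>j p. snd p j))"
  then consider "w = fst" | i where "w = (\<lambda>p. snd p i)" by auto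
  then show "(\<lambda>x. w (fst x, v(j := snd x))) \<in> pol2 sig A"
  proof cases
    case 1
    then show ?thesis using pol2_fst by simp
  next
    case 2
    then show ?thesis using assms(2) pol2_snd by (cases "i = j") (auto intro: polys.const)
  qed
qed

lemma mpol_left:
  assumes "t \<in> mpol sig A" "\<forall>i. v i \<in> carrier A"
  shows "(\<lambda>x. t (x, v)) \<in> pol1 sig A"
proof (rule polys_subst[OF assms(1)])
  have "(\<lambda>x. v j) \<in> pol1 sig A" for j using assms(2) by (blast intro: polys.const)
  then show "(\<lambda>x. w (x, v)) \<in> pol1 sig A" if "w \<in> insert fst (range (\<lambda>j p. snd p j))" for w
    using that pol1_id by auto
qed

lemma mpol_fst: "fst \<in> mpol sig A"
  by (rule polys.var) simp

lemma mpol_precomp: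
  assumes "t \<in> mpol sig A" "f \<in> pol1 sig A"
  shows "(\<lambda>p. t (f (fst p), snd p)) \<in> mpol sig A"
  by (rule polys_subst[OF assms(1)])
    (use polys_comp1[OF assms(2) mpol_fst] in \<open>auto intro: polys.var\<close>)

lemma mpol_eval:
  "wf_trm sig t \<Longrightarrow> (\<lambda>p. eval A (case_nat (fst p) (snd p)) t) \<in> mpol sig A"
proof (induction t)
  case (Var i)
  then show ?case by (cases i) (auto intro: polys.var)
next
  case (App f ts)
  have "(\<lambda>p. opn A f (map (\<lambda>g. g p) (map (\<lambda>t p. eval A (case_nat (fst p) (snd p)) t) ts)))
      \<in> mpol sig A"
    by (rule polys.op) (use App in auto)
  then show ?case by (simp add: comp_def)
qed

context monolith
begin

text \<open>\<open>c\<close> is turned into \<open>d\<close> one coordinate at a time.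
  \<open>H\<close> sees only the function \<open>t (_, v)\<close>, which depends on finitely many
  parameters, so finitely many exchanges suffice.\<close>

lemma eq_along_mu:
  assumes "t \<in> mpol sig A" and "\<And>v w. (\<And>x. t (x, v) = t (x, w)) \<Longrightarrow> H v = H w"
    and step: "\<And>v j y. \<forall>i. v i \<in> carrier A \<Longrightarrow> (v j, y) \<in> \<mu> \<Longrightarrow> H v = H (v(j := y))"
    and cd: "\<forall>j. (c j, d j) \<in> \<mu>"
  shows "H c = H d"
proof -
  obtain n where n: "\<And>x v w. \<forall>j<n. v j = w j \<Longrightarrow> t (x, v) = t (x, w)"
    using mpol_finite_dependence[OF assms(1)] by blast
  define u where "u k = (\<lambda>j. if j < k then d j else c j)" for k
  have "H c = H (u k)" for k
  proof (induction k)
    case 0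
    then show ?case by (simp add: u_def)
  next
    case (Suc k)
    have "u (Suc k) = (u k)(k := d k)" by (auto simp: u_def)
    moreover have "H (u k) = H ((u k)(k := d k))"
      by (rule step) (use cd mu_carrier in \<open>auto simp: u_def\<close>)
    ultimately show ?case using Suc by metis
  qed
  also have "H (u n) = H d" by (rule assms(2), rule n) (simp add: u_def)
  finally show ?thesis .
qed

end

section \<open>The term condition from uniform twins\<close>

context minimal_set
begin

text \<open>A failure of the term condition on the pair \<open>x\<^sub>0\<close>,
  \<open>y\<^sub>0\<close> is refuted in \<open>key\<close>; \<open>least_kernel\<close> then
  carries the condition from this pair to all of \<mu>.\<close>

lemma abelian_of_uniform_twins:
  assumes twin: "\<And>s c d. s \<in> pol2 sig A \<Longrightarrow> (c, d) \<in> \<mu> \<Longrightarrow>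
    e (s (x\<^sub>0, c)) = e (s (y\<^sub>0, c)) \<longleftrightarrow> e (s (x\<^sub>0, d)) = e (s (y\<^sub>0, d))"
  shows "abelian_over sig A \<mu> (Id_on (carrier A))"
proof -
  obtain m where m: "\<And>g x. g ` U \<subseteq> U \<Longrightarrow> inj_on g U \<Longrightarrow> x \<in> U \<Longrightarrow> (g ^^ Suc m) x = x"
    using injective_power[OF finU] by blast
  have inv: "(g ^^ m) (g x) = x" if "g ` U \<subseteq> U" "inj_on g U" "x \<in> U" for g x
    using m[OF that] by (simp add: funpow_swap1)
  have rf: "(x, x) \<in> \<mu>" if "x \<in> carrier A" for x using ConD(2)[OF con] that by auto
  have mtwin: "e (t (x\<^sub>0, c)) = e (t (y\<^sub>0, c)) \<longleftrightarrow> e (t (x\<^sub>0, d)) = e (t (y\<^sub>0, d))"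
    if t: "t \<in> mpol sig A" and cd: "\<forall>j. (c j, d j) \<in> \<mu>" for t c d
  proof (rule eq_along_mu[OF t _ _ cd])
    fix v :: "nat \<Rightarrow> 'a" and j y assume v: "\<forall>i. v i \<in> carrier A" and "(v j, y) \<in> \<mu>"
    from twin[OF mpol_update[OF t v] this(2), of j]
    show "(e (t (x\<^sub>0, v)) = e (t (y\<^sub>0, v))) =
        (e (t (x\<^sub>0, v(j := y))) = e (t (y\<^sub>0, v(j := y))))" by simp
  qed simp
  have key: False
    if t: "t \<in> mpol sig A" and cd: "\<forall>j. (c j, d j) \<in> \<mu>" and ab: "{a, b} = {x\<^sub>0, y\<^sub>0}"
      and eqa: "t (a, c) = t (a, d)" and neb: "t (b, c) \<noteq> t (b, d)" for t c d a b
  proof -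
    have C: "\<forall>j. c j \<in> carrier A" "\<forall>j. d j \<in> carrier A" using cd mu_carrier by auto
    have "{a, b} \<subseteq> U \<inter> carrier A" unfolding ab using xyU xyC by blast
    then have abU: "a \<in> U" "b \<in> U" and abC: "a \<in> carrier A" "b \<in> carrier A" by blast+
    have tC: "t (b, c) \<in> carrier A" "t (b, d) \<in> carrier A"
      using mpol_closed[OF alg t] abC C by auto
    \<comment> \<open>Moves the failure into the minimal set, where the dichotomy applies.\<close>
    obtain f where f: "f \<in> pol1 sig A" "e (f (t (b, c))) \<noteq> e (f (t (b, d)))"
      using separating_polynomial[of x\<^sub>0 y\<^sub>0 e, OF xy(1) _ tC neb] xy by metis
    define t1 where "t1 p = e (f (t p))" for p
    have t1: "t1 \<in> mpol sig A" unfolding t1_def by (intro polys_comp1[OF e] polys_comp1[OF f(1)] t)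
    have t1U: "t1 (x, v) \<in> U" if "x \<in> carrier A" "\<forall>j. v j \<in> carrier A" for x v
      unfolding t1_def using pol1_closed[OF alg f(1) mpol_closed[OF alg t that]] by simp
    have et1: "e (t1 (x, v)) = t1 (x, v)" if "x \<in> carrier A" "\<forall>j. v j \<in> carrier A" for x v
      by (rule eU[OF t1U[OF that]])
    have eqa1: "t1 (a, c) = t1 (a, d)" and neb1: "t1 (b, c) \<noteq> t1 (b, d)"
      using eqa f(2) by (simp_all add: t1_def)
    have ab_cases: "(a = x\<^sub>0 \<and> b = y\<^sub>0) \<or> (a = y\<^sub>0 \<and> b = x\<^sub>0)"
      using ab by (auto simp: doubleton_eq_iff)
    have good_c: "t1 (x\<^sub>0, c) \<noteq> t1 (y\<^sub>0, c)"
    proof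
      assume *: "t1 (x\<^sub>0, c) = t1 (y\<^sub>0, c)"
      then have "t1 (x\<^sub>0, d) = t1 (y\<^sub>0, d)" using mtwin[OF t1 cd] by (simp add: et1 xyC C)
      then show False using * eqa1 neb1 ab_cases by auto
    qed
    \<comment> \<open>Values are discarded when the pair collapses: a polynomial such as
      \<open>snd\<close> collapses it with a value that varies with \<open>y\<close>, so only value
      pairs of separating polynomials can be expected to be invariant along \<mu>.\<close>
    define F where "F s y = (if e (s (x\<^sub>0, y)) = e (s (y\<^sub>0, y)) then None
        else Some (e (s (x\<^sub>0, y)), e (s (y\<^sub>0, y))))"
      for s :: "'a \<times> 'a \<Rightarrow> 'a" and y :: 'a
    show False
    proof (cases "\<forall>s\<in>pol2 sig A. F s x\<^sub>0 = F s y\<^sub>0")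
      case True
      have F: "F s y = F s y'" if "s \<in> pol2 sig A" "(y, y') \<in> \<mu>" for s y y'
      proof (rule least_kernel[where F = F, OF _ xyC xy(2) _ that(2,1)])
        fix s f assume "s \<in> pol2 sig A" "f \<in> pol1 sig A"
        then have "(\<lambda>p. s (fst p, f (snd p))) \<in> pol2 sig A"
          by (intro polys_comp2 polys_comp1[OF \<open>f \<in> pol1 sig A\<close>] pol2_fst pol2_snd)
        then show "\<exists>j\<in>pol2 sig A. \<forall>a\<in>carrier A. F j a = F s (f a)"
          by (rule rev_bexI) (simp add: F_def)
      qed (use True in blast)
      define H where "H v = (if e (t1 (x\<^sub>0, v)) = e (t1 (y\<^sub>0, v)) then None
        else Some (e (t1 (x\<^sub>0, v)), e (t1 (y\<^sub>0, v))))" for v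
      \<comment> \<open>By \<open>good_c\<close> the left side is not \<open>None\<close>, so this
        equality compares actual values, among them those at \<open>b\<close>.\<close>
      have "H c = H d"
      proof (rule eq_along_mu[OF t1 _ _ cd])
        fix v :: "nat \<Rightarrow> 'a" and j y assume v: "\<forall>i. v i \<in> carrier A" and "(v j, y) \<in> \<mu>"
        from F[OF mpol_update[OF t1 v] this(2), of j]
        show "H v = H (v(j := y))" unfolding F_def H_def fst_conv snd_conv fun_upd_triv .
      qed (simp add: H_def)
      then have "t1 (b, c) = t1 (b, d)"
        using good_c ab_cases by (auto simp: H_def et1 xyC C split: if_splits)
      then show False using neb1 by simp
    next
      case False
      txt \<open>
        Then \<open>s\<close> can be normalised to a right loop with unit \<open>x\<^sub>0\<close>. Dividing \<open>t\<close> by \<open>x\<close> in it gives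
        a polynomial that collapses at the parameters \<open>c\<close> but not at \<open>d\<close>.
      \<close>
      then obtain s where s: "s \<in> pol2 sig A" "F s x\<^sub>0 \<noteq> F s y\<^sub>0" by blast
      then have s0: "e (s (x\<^sub>0, x\<^sub>0)) \<noteq> e (s (y\<^sub>0, x\<^sub>0))"
        and s1: "e (s (x\<^sub>0, x\<^sub>0)) \<noteq> e (s (x\<^sub>0, y\<^sub>0)) \<or> e (s (y\<^sub>0, x\<^sub>0)) \<noteq> e (s (y\<^sub>0, y\<^sub>0))"
        using twin[OF s(1) xy(1)] by (auto simp: F_def split: if_splits)
      \<comment> \<open>Swapping the variables of \<open>s\<close> applies the twin hypothesis to
        rows: if one of the rows of \<open>x\<^sub>0\<close> and \<open>y\<^sub>0\<close> separates
        these two elements, both do.\<close>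
      have s2: "e (s (x, x\<^sub>0)) \<noteq> e (s (x, y\<^sub>0))" if "x \<in> {x\<^sub>0, y\<^sub>0}" for x
        using s1 twin[OF pol2_swap[OF s(1)] xy(1)] that by auto
      define q where "q = (\<lambda>x. e (s (x, x\<^sub>0)))"
      have q1: "(\<lambda>x. s (x, x\<^sub>0)) \<in> pol1 sig A" by (rule pol2_left[OF s(1) xyC(1)])
      have q: "q \<in> pol1 sig A" unfolding q_def by (rule polys_comp1[OF e q1])
      have qU: "q ` U \<subseteq> U" unfolding q_def by (rule eU_maps[OF q1])
      have qinj: "inj_on q U" unfolding q_def by (rule dichotomy[OF q1 xy(1) xyU s0])
      define s' where "s' p = (q ^^ m) (e (s p))" for p
      have s': "s' \<in> pol2 sig A" unfolding s'_def
        by (intro polys_comp1[OF pol1_funpow[OF q]] polys_comp1[OF e] s(1))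
      have s'x0: "s' (x, x\<^sub>0) = x" if "x \<in> U" for x
        using inv[OF qU qinj that] by (simp add: s'_def q_def)
      have s'U: "s' (x, y) \<in> U" if "x \<in> carrier A" "y \<in> carrier A" for x y
        unfolding s'_def using funpow_in[OF qU] pol2_closed[OF alg s(1) that] by auto
      have s'U': "(\<lambda>y. s' (x, y)) ` U \<subseteq> U" if "x \<in> {x\<^sub>0, y\<^sub>0}" for x
        using s'U U_sub xyC that by blast
      have s'inj: "inj_on (\<lambda>y. s' (x, y)) U" if "x \<in> {x\<^sub>0, y\<^sub>0}" for x
      proof -
        have sx: "(\<lambda>y. s (x, y)) \<in> pol1 sig A" by (rule pol2_right[OF s(1)]) (use that xyC in blast)
        have "inj_on (\<lambda>y. e (s (x, y))) U" by (rule dichotomy[OF sx xy(1) xyU s2[OF that]])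
        moreover have "inj_on (q ^^ m) ((\<lambda>y. e (s (x, y))) ` U)"
          by (rule inj_on_subset[OF inj_on_funpow[OF qU qinj] eU_maps[OF sx]])
        ultimately show ?thesis unfolding s'_def using comp_inj_on by (fastforce simp: comp_def)
      qed
      \<comment> \<open>Left division: for \<open>x\<close> in \<open>{x\<^sub>0, y\<^sub>0}\<close>
        it inverts \<open>s' (x, _)\<close> on \<open>U\<close>, hence \<open>L (x, x)\<close> is
        the unit \<open>x\<^sub>0\<close>.\<close>
      define L where "L p = ((\<lambda>z. s' (fst p, z)) ^^ m) (snd p)" for p
      have L: "L \<in> pol2 sig A" unfolding L_def by (rule pol2_funpow[OF s'])
      have Ls': "L (x, s' (x, y)) = y" if "x \<in> {x\<^sub>0, y\<^sub>0}" "y \<in> U" for x y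
        unfolding L_def using inv[OF s'U'[OF that(1)] s'inj[OF that(1)] that(2)] by simp
      have Lx: "L (x, x) = x\<^sub>0" if "x \<in> {x\<^sub>0, y\<^sub>0}" for x
        using Ls'[OF that xyU(1)] s'x0[of x] that xyU by auto
      have Linj: "inj_on (\<lambda>z. L (x, z)) U" if "x \<in> {x\<^sub>0, y\<^sub>0}" for x
        unfolding L_def using inj_on_funpow[OF s'U'[OF that] s'inj[OF that]] by simp
      have LU: "L (x, z) \<in> U" if "x \<in> {x\<^sub>0, y\<^sub>0}" "z \<in> U" for x z
        unfolding L_def using funpow_in[OF s'U'[OF that(1)] that(2)] by simp
      define r where "r = (\<lambda>x. t1 (x, c))"
      have r: "r \<in> pol1 sig A" unfolding r_def by (rule mpol_left[OF t1 C(1)])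
      have er: "e (r x) = r x" if "x \<in> carrier A" for x unfolding r_def by (rule et1[OF that C(1)])
      have "inj_on (\<lambda>x. e (r x)) U"
        by (rule dichotomy[OF r xy(1) xyU]) (use good_c er xyC in \<open>simp add: r_def\<close>)
      then have rinj: "inj_on r U" using er U_sub by (simp add: inj_on_def subset_iff)
      have rU: "r ` U \<subseteq> U" using t1U C(1) U_sub unfolding r_def by blast
      \<comment> \<open>Normalised so that \<open>t' (_, c)\<close> is the identity on
        \<open>U\<close>; the failure then reads \<open>t' (a, d) = a\<close> and
        \<open>t' (b, d) \<noteq> b\<close>.\<close>
      define t' where "t' p = (r ^^ m) (t1 p)" for p
      have t': "t' \<in> mpol sig A" unfolding t'_def by (intro polys_comp1[OF pol1_funpow[OF r]] t1)
      have t'c: "t' (x, c) = x" if "x \<in> U" for x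
        using inv[OF rU rinj that] by (simp add: t'_def r_def)
      have t'a: "t' (a, d) = a" using t'c[OF abU(1)] eqa1 by (simp add: t'_def)
      have t'b: "t' (b, d) \<noteq> b"
      proof
        assume "t' (b, d) = b"
        then have "(r ^^ m) (t1 (b, d)) = (r ^^ m) (t1 (b, c))"
          using t'c[OF abU(2)] by (simp add: t'_def)
        then show False
          using inj_on_funpow[OF rU rinj, of m] neb1 t1U[OF abC(2) C(1)] t1U[OF abC(2) C(2)]
          by (metis inj_onD)
      qed
      have t'bU: "t' (b, d) \<in> U"
        unfolding t'_def by (rule funpow_in[OF rU t1U[OF abC(2) C(2)]])
      define w where "w p = L (fst p, t' p)" for p
      have w: "w \<in> mpol sig A" unfolding w_def by (rule polys_comp2[OF L mpol_fst t'])
      have "w (x, c) = x\<^sub>0" if "x \<in> {x\<^sub>0, y\<^sub>0}" for x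
        using t'c[of x] Lx[OF that] that xyU by (auto simp: w_def)
      then have "e (w (x\<^sub>0, d)) = e (w (y\<^sub>0, d))" using mtwin[OF w cd] by simp
      moreover have wa: "w (a, d) = x\<^sub>0" using t'a Lx[of a] ab by (auto simp: w_def)
      moreover have "w (b, d) \<noteq> x\<^sub>0"
        using inj_onD[OF Linj[of b], of "t' (b, d)" b] t'b t'bU abU(2) Lx[of b] ab
        by (auto simp: w_def simp del: image_iff)
      moreover have "e (w (b, d)) = w (b, d)"
        unfolding w_def fst_conv by (rule eU, rule LU[OF _ t'bU]) (use ab in blast)
      ultimately show False using ab_cases xy(3) by auto
    qed
  qed
  \<comment> \<open>Each instance of the term condition becomes a truth-valued function of the base
    point; precomposition with a polynomial changes only the first component of the index.\<close>
  define I where "I = {(t, c, d :: nat \<Rightarrow> 'a). t \<in> mpol sig A \<and> (\<forall>j. (c j, d j) \<in> \<mu>)}"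
  define G where "G = (\<lambda>(t :: 'a \<times> (nat \<Rightarrow> 'a) \<Rightarrow> 'a, c, d) a. t (a, c) = t (a, d))"
  have term_condition: "G i a = G i b" if "(a, b) \<in> \<mu>" "i \<in> I" for i a b
  proof (rule least_kernel[where F = G, OF _ xyC xy(2) _ that])
    fix i f assume i: "i \<in> I" and f: "f \<in> pol1 sig A"
    obtain t c d where tcd: "i = (t, c, d)" by (cases i)
    show "\<exists>j\<in>I. \<forall>a\<in>carrier A. G j a = G i (f a)"
      by (rule bexI[of _ "(\<lambda>p. t (f (fst p), snd p), c, d)"])
        (use i mpol_precomp[OF _ f] in \<open>auto simp: tcd I_def G_def\<close>)
  next
    fix i assume i: "i \<in> I"
    obtain t c d where tcd: "i = (t, c, d)" by (cases i)
    show "G i x\<^sub>0 = G i y\<^sub>0"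
      using key[of t c d x\<^sub>0 y\<^sub>0] key[of t c d y\<^sub>0 x\<^sub>0] i by (auto simp: tcd I_def G_def)
  qed
  show ?thesis unfolding abelian_over_def
  proof (intro allI impI)
    fix t a b and c d :: "nat \<Rightarrow> 'a"
    assume t: "wf_trm sig t" and ab: "(a, b) \<in> \<mu>" and cd: "\<forall>j. (c j, d j) \<in> \<mu>"
      and eq: "(eval A (case_nat a c) t, eval A (case_nat a d) t) \<in> Id_on (carrier A)"
    let ?g = "\<lambda>p. eval A (case_nat (fst p) (snd p)) t"
    have g: "?g \<in> mpol sig A" by (rule mpol_eval[OF t])
    then have "(?g, c, d) \<in> I" using cd by (simp add: I_def)
    from term_condition[OF ab this] eq have "?g (b, c) = ?g (b, d)" by (auto simp: G_def)
    moreover have "?g (b, c) \<in> carrier A"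
      by (rule mpol_closed[OF alg g]) (use ab cd mu_carrier in auto)
    ultimately show "(eval A (case_nat b c) t, eval A (case_nat b d) t) \<in> Id_on (carrier A)" by auto
  qed
qed

text \<open>If collapsing the pair agreed at the parameters \<open>x\<^sub>0\<close> and
  \<open>y\<^sub>0\<close> for every binary polynomial, it would agree along \<mu>, and \<mu> would
  be abelian. A polynomial where it disagrees has mixed twins.\<close>

lemma abelian_or_pseudo_meet:
  assumes "\<not> abelian_over sig A \<mu> (Id_on (carrier A))"
  obtains p z\<^sub>1 z\<^sub>0 where "p \<in> pol2 sig A" "{z\<^sub>1, z\<^sub>0} = {x\<^sub>0, y\<^sub>0}"
    "p (z\<^sub>1, z\<^sub>1) = z\<^sub>1" "p (z\<^sub>1, z\<^sub>0) = z\<^sub>0" "p (z\<^sub>0, z\<^sub>1) = z\<^sub>0" "p (z\<^sub>0, z\<^sub>0) = z\<^sub>0"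
proof -
  define T where "T s c \<longleftrightarrow> e (s (x\<^sub>0, c)) = e (s (y\<^sub>0, c))"
    for s :: "'a \<times> 'a \<Rightarrow> 'a" and c :: 'a
  have "\<exists>s\<in>pol2 sig A. T s x\<^sub>0 \<noteq> T s y\<^sub>0"
  proof (rule ccontr)
    assume *: "\<not> ?thesis"
    have "T s c = T s d" if "s \<in> pol2 sig A" "(c, d) \<in> \<mu>" for s c d
    proof (rule least_kernel[where F = T, OF _ xyC xy(2) _ that(2,1)])
      fix s f assume "s \<in> pol2 sig A" "f \<in> pol1 sig A"
      then have "(\<lambda>p. s (fst p, f (snd p))) \<in> pol2 sig A"
        by (intro polys_comp2 polys_comp1[OF \<open>f \<in> pol1 sig A\<close>] pol2_fst pol2_snd)
      then show "\<exists>j\<in>pol2 sig A. \<forall>a\<in>carrier A. T j a = T s (f a)"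
        by (rule rev_bexI) (simp add: T_def)
    qed (use * in blast)
    then show False using abelian_of_uniform_twins assms unfolding T_def by blast
  qed
  then obtain s where s: "s \<in> pol2 sig A" "T s x\<^sub>0 \<noteq> T s y\<^sub>0" by blast
  define a b where "a = (if T s x\<^sub>0 then y\<^sub>0 else x\<^sub>0)" and "b = (if T s x\<^sub>0 then x\<^sub>0 else y\<^sub>0)"
  have "{a, b} = {x\<^sub>0, y\<^sub>0}" "\<not> T s a" "T s b" using s(2) by (auto simp: a_def b_def)
  then show thesis using pseudo_meet_of_mixed_twins[OF s(1)] that unfolding T_def by metis
qed

end

section \<open>Solvable congruences have no pseudo-meets\<close>

text \<open>
  The relation \<open>\<epsilon>\<close> plays the part of the solvable radical over \<open>\<Psi>\<close> in tame congruence theory. It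
  is defined by the twin property: replacing a parameter by an \<open>\<epsilon>\<close>-related one keeps a polynomial
  permuting, modulo \<open>\<Psi>\<close>, the range of an idempotent polynomial.
\<close>

locale abelian_mod =
  fixes sig :: "'f \<rightharpoonup> nat" and C :: "('f, 'c) algebra" and \<eta> \<Psi> :: "'c rel"
  assumes alg: "is_algebra sig C" and fin: "finite (carrier C)"
    and eta: "\<eta> \<in> Con sig C" and Psi: "\<Psi> \<in> Con sig C"
    and term_condition: "\<And>q u v c d. q \<in> pol2 sig C \<Longrightarrow> (u, v) \<in> \<eta> \<Longrightarrow> (c, d) \<in> \<eta> \<Longrightarrow>
      q (u, c) = q (u, d) \<Longrightarrow> q (v, c) = q (v, d)"
begin

definition injective_mod :: "('c \<Rightarrow> 'c) \<Rightarrow> ('c \<Rightarrow> 'c) \<Rightarrow> bool" where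
  "injective_mod e g \<longleftrightarrow>
    (\<forall>y\<in>e ` carrier C. \<forall>y'\<in>e ` carrier C. (e (g y), e (g y')) \<in> \<Psi> \<longrightarrow> (y, y') \<in> \<Psi>)"

definition idem_pairs :: "(('c \<Rightarrow> 'c) \<times> ('c \<times> 'c \<Rightarrow> 'c)) set" where
  "idem_pairs = {(e, q). e \<in> pol1 sig C \<and> (\<forall>x\<in>carrier C. e (e x) = e x) \<and> q \<in> pol2 sig C}"

definition \<epsilon> :: "'c rel" where
  "\<epsilon> = {(w, w') \<in> carrier C \<times> carrier C. \<forall>i\<in>idem_pairs.
    injective_mod (fst i) (\<lambda>y. snd i (w, y)) = injective_mod (fst i) (\<lambda>y. snd i (w', y))}"

lemma eps: "\<epsilon> \<in> Con sig C"
  unfolding \<epsilon>_def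
proof (rule ConI_kernel[OF alg])
  fix i f assume i: "i \<in> idem_pairs" and f: "f \<in> pol1 sig C"
  obtain e q where eq: "i = (e, q)" by (cases i)
  have "(\<lambda>p. q (f (fst p), snd p)) \<in> pol2 sig C"
    using i unfolding idem_pairs_def eq
    by (intro polys_comp2 polys_comp1[OF f] pol2_fst pol2_snd) simp
  then have "(e, \<lambda>p. q (f (fst p), snd p)) \<in> idem_pairs" using i by (simp add: idem_pairs_def eq)
  then show "\<exists>j\<in>idem_pairs. \<forall>a\<in>carrier C. injective_mod (fst j) (\<lambda>y. snd j (a, y)) =
      injective_mod (fst i) (\<lambda>y. snd i (f a, y))"
    by (rule rev_bexI) (simp add: eq)
qed

lemma Psi_sym: "(x, y) \<in> \<Psi> \<Longrightarrow> (y, x) \<in> \<Psi>"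
  and Psi_trans: "(x, y) \<in> \<Psi> \<Longrightarrow> (y, z) \<in> \<Psi> \<Longrightarrow> (x, z) \<in> \<Psi>"
  and Psi_refl: "x \<in> carrier C \<Longrightarrow> (x, x) \<in> \<Psi>"
  using ConD(2-4)[OF Psi] by (auto dest: symD transD)

lemma eta_sym: "(x, y) \<in> \<eta> \<Longrightarrow> (y, x) \<in> \<eta>"
  and eta_trans: "(x, y) \<in> \<eta> \<Longrightarrow> (y, z) \<in> \<eta> \<Longrightarrow> (x, z) \<in> \<eta>"
  using ConD(3,4)[OF eta] by (auto dest: symD transD)

lemma eps_sym: "(x, y) \<in> \<epsilon> \<Longrightarrow> (y, x) \<in> \<epsilon>"
  and eps_trans: "(x, y) \<in> \<epsilon> \<Longrightarrow> (y, z) \<in> \<epsilon> \<Longrightarrow> (x, z) \<in> \<epsilon>"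
  and eps_refl: "x \<in> carrier C \<Longrightarrow> (x, x) \<in> \<epsilon>"
  using ConD(2-4)[OF eps] by (auto dest: symD transD)

lemma Psi_eps:
  assumes "(w, w') \<in> \<Psi>"
  shows "(w, w') \<in> \<epsilon>"
proof -
  have *: "injective_mod e (\<lambda>y. q (w', y))"
    if inj: "injective_mod e (\<lambda>y. q (w, y))" and ww: "(w, w') \<in> \<Psi>"
      and e: "e \<in> pol1 sig C" and q: "q \<in> pol2 sig C" for w w' e q
    unfolding injective_mod_def
  proof (intro ballI impI)
    fix y y' assume y: "y \<in> e ` carrier C" "y' \<in> e ` carrier C"
      and r: "(e (q (w', y)), e (q (w', y'))) \<in> \<Psi>"
    have "(e (q (w, z)), e (q (w', z))) \<in> \<Psi>" if "z \<in> e ` carrier C" for z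
      using that pol1_closed[OF alg e]
      by (intro Con_pol1[OF Psi _ ww, of "\<lambda>x. e (q (x, z))"] polys_comp1[OF e] pol2_left[OF q]) auto
    then have "(e (q (w, y)), e (q (w, y'))) \<in> \<Psi>" using y r by (meson Psi_sym Psi_trans)
    then show "(y, y') \<in> \<Psi>" using inj y unfolding injective_mod_def by blast
  qed
  have "w \<in> carrier C" "w' \<in> carrier C" using ConD(1)[OF Psi] assms by auto
  then show ?thesis
    unfolding \<epsilon>_def idem_pairs_def using *[OF _ assms] *[OF _ Psi_sym[OF assms]] by auto
qed

text \<open>Idempotent powers \<open>h\<close>, \<open>h'\<close> of the two specialisations are
  compared. On the range of \<open>h\<close> the map \<open>h \<circ> h'\<close> moves points only
  within \<eta>-classes, and the term condition makes it injective there; a power inverts it, so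
  \<open>h'\<close> inherits injectivity modulo \<Psi>.\<close>

lemma eta_injective_mod:
  assumes inj: "injective_mod e (\<lambda>y. q (w, y))" and ww: "(w, w') \<in> \<eta>"
    and e: "e \<in> pol1 sig C" and idem: "\<And>x. x \<in> carrier C \<Longrightarrow> e (e x) = e x"
    and q: "q \<in> pol2 sig C"
  shows "injective_mod e (\<lambda>y. q (w', y))"
proof -
  let ?D = "carrier C" and ?U = "e ` carrier C"
  have wD: "w \<in> ?D" "w' \<in> ?D" using ConD(1)[OF eta] ww by auto
  obtain K where K: "K > 0"
    "\<And>f x. f ` ?D \<subseteq> ?D \<Longrightarrow> x \<in> ?D \<Longrightarrow> (f ^^ K) ((f ^^ K) x) = (f ^^ K) x"
    using idempotent_power[OF fin] by blast
  have UD: "?U \<subseteq> ?D" using pol1_closed[OF alg e] by auto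
  have eq: "(\<lambda>p. e (q p)) \<in> pol2 sig C" by (rule polys_comp1[OF e q])
  \<comment> \<open>One binary polynomial has both powers as specialisations, at \<open>w\<close>
    and at \<open>w'\<close>; the uniform exponent makes this possible.\<close>
  define H where "H p = ((\<lambda>z. e (q (fst p, z))) ^^ K) (snd p)" for p
  have H: "H \<in> pol2 sig C" unfolding H_def by (rule pol2_funpow[OF eq])
  define g g' where "g = (\<lambda>y. e (q (w, y)))" and "g' = (\<lambda>y. e (q (w', y)))"
  have gU: "g ` ?D \<subseteq> ?U" unfolding g_def using pol2_closed[OF alg q wD(1)] by auto
  have g': "g' \<in> pol1 sig C" unfolding g'_def by (rule polys_comp1[OF e pol2_right[OF q wD(2)]])
  define h h' where "h = g ^^ K" and "h' = g' ^^ K"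
  have hH: "h y = H (w, y)" "h' y = H (w', y)" for y
    by (simp_all add: h_def h'_def g_def g'_def H_def)
  have h: "h \<in> pol1 sig C"
    unfolding h_def g_def by (intro pol1_funpow polys_comp1[OF e] pol2_right[OF q wD(1)])
  have h': "h' \<in> pol1 sig C" unfolding h'_def by (rule pol1_funpow[OF g'])
  have hh: "h (h y) = h y" if "y \<in> ?D" for y
    unfolding h_def by (rule K(2)[OF _ that]) (use gU UD in blast)
  have hU: "h y \<in> ?U" if "y \<in> ?U" for y
    unfolding h_def by (rule funpow_in[OF _ that]) (use gU UD in blast)
  have inj_pow: "(y, y') \<in> \<Psi>" if "((g ^^ n) y, (g ^^ n) y') \<in> \<Psi>" "y \<in> ?U" "y' \<in> ?U" for n y y'
    using that
  proof (induction n arbitrary: y y')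
    case (Suc n)
    have "g y \<in> ?U" "g y' \<in> ?U" using Suc.prems(2,3) gU UD by blast+
    then have "(g y, g y') \<in> \<Psi>" by (rule Suc.IH[rotated]) (use Suc.prems(1) in \<open>simp add: funpow_swap1\<close>)
    then show ?case using inj Suc.prems(2,3) unfolding injective_mod_def g_def by blast
  qed simp
  \<comment> \<open>\<open>g\<close> is injective modulo \<Psi> on the range of \<open>e\<close>, so
    its idempotent power acts there as the identity modulo \<Psi>.\<close>
  have hid: "(h y, y) \<in> \<Psi>" if "y \<in> ?U" for y
  proof (rule inj_pow[where n = K])
    have "h y \<in> ?D" "y \<in> ?D" using hU[OF that] UD that by auto
    then show "((g ^^ K) (h y), (g ^^ K) y) \<in> \<Psi>"
      using hh Psi_refl unfolding h_def by simp
  qed (use that hU in blast)+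
  let ?V = "h ` ?D"
  have VD: "?V \<subseteq> ?D" using pol1_closed[OF alg h] by auto
  define f where "f y = h (h' y)" for y
  have f: "f \<in> pol1 sig C" unfolding f_def by (rule polys_comp1[OF h h'])
  have fV: "f ` ?V \<subseteq> ?V" unfolding f_def using pol1_closed[OF alg h'] VD by auto
  have hV: "h y = y" if "y \<in> ?V" for y using hh that by auto
  have feta: "(y, f y) \<in> \<eta>" if "y \<in> ?V" for y
  proof -
    have "(\<lambda>x. H (x, y)) \<in> pol1 sig C" by (rule pol2_left[OF H]) (use that VD in blast)
    then have "(h y, h' y) \<in> \<eta>" unfolding hH by (rule Con_pol1[OF eta _ ww])
    then have "(h (h y), h (h' y)) \<in> \<eta>" by (rule Con_pol1[OF eta h])
    then show ?thesis using hV[OF that] by (simp add: f_def)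
  qed
  \<comment> \<open>The term condition asks for \<eta>-related arguments. Two points with the same
    image are such, because \<open>f\<close> moves each within its \<eta>-class.\<close>
  have finj: "inj_on f ?V"
  proof (rule inj_onI)
    fix y y' assume y: "y \<in> ?V" "y' \<in> ?V" and "f y = f y'"
    then have "(y, y') \<in> \<eta>" using feta eta_sym eta_trans by metis
    from term_condition[OF polys_comp1[OF h H] eta_sym[OF ww] this] \<open>f y = f y'\<close>
    have "h (h y) = h (h y')" by (simp add: f_def hH)
    then show "y = y'" using hV y by metis
  qed
  obtain m where m: "\<And>f x. f ` ?V \<subseteq> ?V \<Longrightarrow> inj_on f ?V \<Longrightarrow> x \<in> ?V \<Longrightarrow> (f ^^ Suc m) x = x"
    using injective_power[of ?V] fin by blast
  show ?thesis unfolding injective_mod_def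
  proof (intro ballI impI)
    fix y y' assume y: "y \<in> ?U" "y' \<in> ?U" and r: "(e (q (w', y)), e (q (w', y'))) \<in> \<Psi>"
    obtain k where k: "K = Suc k" using K(1) gr0_implies_Suc by blast
    have "((g' ^^ k) (g' y), (g' ^^ k) (g' y')) \<in> \<Psi>"
      using Con_pol1[OF Psi pol1_funpow[OF g'] r] by (simp add: g'_def)
    then have "(h' y, h' y') \<in> \<Psi>" unfolding h'_def k by (simp add: funpow_swap1)
    then have "(h' (h y), h' (h y')) \<in> \<Psi>"
      using Con_pol1[OF Psi h' hid[OF y(1)]] Con_pol1[OF Psi h' hid[OF y(2)]]
      by (meson Psi_sym Psi_trans)
    then have "(f (h y), f (h y')) \<in> \<Psi>" unfolding f_def by (rule Con_pol1[OF Psi h])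
    then have "((f ^^ m) (f (h y)), (f ^^ m) (f (h y'))) \<in> \<Psi>"
      by (rule Con_pol1[OF Psi pol1_funpow[OF f]])
    moreover have "(f ^^ m) (f (h z)) = h z" if "z \<in> ?U" for z
      using m[OF fV finj, of "h z"] that UD by (auto simp: funpow_swap1)
    ultimately have "(h y, h y') \<in> \<Psi>" using y by simp
    then show "(y, y') \<in> \<Psi>" using hid y by (meson Psi_sym Psi_trans)
  qed
qed

lemma eta_eps:
  assumes "(w, w') \<in> \<eta>"
  shows "(w, w') \<in> \<epsilon>"
proof -
  have "w \<in> carrier C" "w' \<in> carrier C" using ConD(1)[OF eta] assms by auto
  then show ?thesis
    unfolding \<epsilon>_def idem_pairs_def
    using eta_injective_mod[OF _ assms] eta_injective_mod[OF _ eta_sym[OF assms]] by auto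
qed

text \<open>For an idempotent power \<open>e\<close> of \<open>p (u, _)\<close>, the map
  \<open>p (u, _)\<close> permutes the range of \<open>e\<close>, and \<epsilon> transfers
  injectivity modulo \<Psi> to \<open>e \<circ> p (v, _)\<close>. But the latter maps
  \<open>e u\<close> and \<open>e v\<close> into the \<Psi>-class of \<open>v\<close>, so they, and
  with them \<open>u\<close> and \<open>v\<close>, are \<Psi>-related.\<close>

lemma no_pseudo_meet:
  assumes uv: "(u, v) \<in> \<epsilon>" and p: "p \<in> pol2 sig C" and uu: "(p (u, u), u) \<in> \<Psi>"
    and uv': "(p (u, v), v) \<in> \<Psi>" and vu: "(p (v, u), v) \<in> \<Psi>" and vv: "(p (v, v), v) \<in> \<Psi>"
  shows "(u, v) \<in> \<Psi>"
proof -
  let ?D = "carrier C"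
  have D: "u \<in> ?D" "v \<in> ?D" using ConD(1)[OF eps] uv by auto
  obtain K where K: "K > 0"
    "\<And>f x. f ` ?D \<subseteq> ?D \<Longrightarrow> x \<in> ?D \<Longrightarrow> (f ^^ K) ((f ^^ K) x) = (f ^^ K) x"
    using idempotent_power[OF fin] by blast
  define f where "f = (\<lambda>y. p (u, y))"
  have f: "f \<in> pol1 sig C" unfolding f_def by (rule pol2_right[OF p D(1)])
  have fD: "f ` ?D \<subseteq> ?D" using pol1_closed[OF alg f] by auto
  define e where "e = f ^^ K"
  have e: "e \<in> pol1 sig C" unfolding e_def by (rule pol1_funpow[OF f])
  have idem: "e (e x) = e x" if "x \<in> ?D" for x unfolding e_def by (rule K(2)[OF fD that])
  have eD: "e x \<in> ?D" if "x \<in> ?D" for x using pol1_closed[OF alg e that] .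
  have "injective_mod e (\<lambda>y. p (u, y))" unfolding injective_mod_def
  proof (intro ballI impI)
    fix y y' assume y: "y \<in> e ` ?D" "y' \<in> e ` ?D" and r: "(e (p (u, y)), e (p (u, y'))) \<in> \<Psi>"
    have ey: "e y = y" "e y' = y'" using idem y by auto
    have ef: "e (f z) = f (e z)" for z unfolding e_def by (simp add: funpow_swap1)
    have "(f y, f y') \<in> \<Psi>" using r ef[of y] ef[of y'] ey by (simp add: f_def)
    moreover obtain k where k: "K = Suc k" using K(1) gr0_implies_Suc by blast
    ultimately have "((f ^^ k) (f y), (f ^^ k) (f y')) \<in> \<Psi>"
      by (intro Con_pol1[OF Psi pol1_funpow[OF f]])
    then have "(e y, e y') \<in> \<Psi>" unfolding e_def k by (simp add: funpow_swap1)
    then show "(y, y') \<in> \<Psi>" by (simp add: ey)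
  qed
  moreover have "(e, p) \<in> idem_pairs" using e idem p by (simp add: idem_pairs_def)
  ultimately have inj: "injective_mod e (\<lambda>y. p (v, y))" using uv unfolding \<epsilon>_def by force
  have eu: "((f ^^ n) u, u) \<in> \<Psi>" and ev: "((f ^^ n) v, v) \<in> \<Psi>" for n
  proof (induction n)
    case (Suc n)
    { case 1
      show ?case using Con_pol1[OF Psi f Suc.IH(1)] uu Psi_trans by (simp add: f_def) }
    { case 2
      show ?case using Con_pol1[OF Psi f Suc.IH(2)] uv' Psi_trans by (simp add: f_def) }
  qed (use D Psi_refl in auto)
  have eu: "(e u, u) \<in> \<Psi>" and ev: "(e v, v) \<in> \<Psi>" using eu ev by (auto simp: e_def)
  have pv: "(\<lambda>y. e (p (v, y))) \<in> pol1 sig C" by (rule polys_comp1[OF e pol2_right[OF p D(2)]])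
  have "(e (p (v, e u)), v) \<in> \<Psi>"
    using Con_pol1[OF Psi pv eu] Con_pol1[OF Psi e vu] ev by (meson Psi_trans)
  moreover have "(e (p (v, e v)), v) \<in> \<Psi>"
    using Con_pol1[OF Psi pv ev] Con_pol1[OF Psi e vv] ev by (meson Psi_trans)
  ultimately have "(e (p (v, e u)), e (p (v, e v))) \<in> \<Psi>" by (meson Psi_trans Psi_sym)
  then have "(e u, e v) \<in> \<Psi>" using inj D unfolding injective_mod_def by blast
  then show ?thesis using eu ev by (meson Psi_trans Psi_sym)
qed

end

section \<open>Polynomials along a bridge\<close>

text \<open>Used with \<open>snd\<close> for \<open>h\<close>: polynomials of the subpower
  \<open>C\<close> act on second coordinates as polynomials of \<open>B\<close>.\<close>

lemma polys_hom:
  assumes "\<And>f xs. h (opn C f xs) = opn B f (map h xs)" "h ` carrier C \<subseteq> carrier B"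
    and "g \<in> polys sig C V" and var: "\<And>v. v \<in> V \<Longrightarrow> \<exists>w\<in>W. \<forall>x. h (v x) = w (\<phi> x)"
  shows "\<exists>g'\<in>polys sig B W. \<forall>x. h (g x) = g' (\<phi> x)"
  using assms(3)
proof induction
  case (var v)
  then show ?case using assms(4) by (meson polys.var)
next
  case (const a)
  then have "(\<lambda>_. h a) \<in> polys sig B W" using assms(2) by (blast intro: polys.const)
  then show ?case by (rule rev_bexI) simp
next
  case (op f gs)
  then have "\<forall>g\<in>set gs. \<exists>g'. g' \<in> polys sig B W \<and> (\<forall>x. h (g x) = g' (\<phi> x))" by auto
  then obtain G where G: "\<forall>g\<in>set gs. G g \<in> polys sig B W \<and> (\<forall>x. h (g x) = G g (\<phi> x))" by metis
  have "(\<lambda>x. opn B f (map (\<lambda>g. g x) (map G gs))) \<in> polys sig B W"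
    by (rule polys.op) (use op G in auto)
  then show ?case
  proof (rule rev_bexI)
    show "\<forall>x. h (opn C f (map (\<lambda>g. g x) gs)) = opn B f (map (\<lambda>g. g (\<phi> x)) (map G gs))"
      using G by (auto simp: assms(1) comp_def intro!: arg_cong[where f = "opn B f"])
  qed
qed

text \<open>A constant acts on pairs as a diagonal pair, which has a partner by assumption;
  replacing each constant by such a partner lifts \<open>p\<close>. The set \<open>D\<close> of
  argument triples expresses that one lift serves them all.\<close>

lemma polys_lift_diagonal:
  assumes T: "subuniverse sig (prod_alg (prod_alg A A) Y) T"
    and const: "\<And>a. a \<in> carrier A \<Longrightarrow> \<exists>y\<in>carrier Y. ((a, a), y) \<in> T"
    and var: "\<And>v. v \<in> V \<Longrightarrow> \<exists>w\<in>W. \<forall>(x\<^sub>1, x\<^sub>2, y)\<in>D. ((v x\<^sub>1, v x\<^sub>2), w y) \<in> T"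
    and p: "p \<in> polys sig A V"
  shows "\<exists>P\<in>polys sig Y W. \<forall>(x\<^sub>1, x\<^sub>2, y)\<in>D. ((p x\<^sub>1, p x\<^sub>2), P y) \<in> T"
  using p
proof induction
  case (var v)
  then show ?case using assms(3) by (meson polys.var)
next
  case (const a)
  then obtain y where "y \<in> carrier Y" "((a, a), y) \<in> T" using assms(2) by blast
  then show ?case by (intro bexI[OF _ polys.const]) auto
next
  case (op f gs)
  then have "\<forall>g\<in>set gs. \<exists>G. G \<in> polys sig Y W \<and> (\<forall>(x\<^sub>1, x\<^sub>2, y)\<in>D. ((g x\<^sub>1, g x\<^sub>2), G y) \<in> T)"
    by auto
  then obtain G where G: "\<forall>g\<in>set gs. G g \<in> polys sig Y W \<and>
      (\<forall>(x\<^sub>1, x\<^sub>2, y)\<in>D. ((g x\<^sub>1, g x\<^sub>2), G g y) \<in> T)" by metis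
  have "(\<lambda>x. opn Y f (map (\<lambda>g. g x) (map G gs))) \<in> polys sig Y W"
    by (rule polys.op) (use op G in auto)
  then show ?case
  proof (rule rev_bexI, clarify)
    fix x\<^sub>1 x\<^sub>2 y assume D: "(x\<^sub>1, x\<^sub>2, y) \<in> D"
    let ?xs = "map (\<lambda>g. ((g x\<^sub>1, g x\<^sub>2), G g y)) gs"
    have "((g x\<^sub>1, g x\<^sub>2), G g y) \<in> T" if "g \<in> set gs" for g
      using bspec[OF conjunct2[OF bspec[OF G that]] D] by simp
    then have "set ?xs \<subseteq> T" by auto
    then have "opn (prod_alg (prod_alg A A) Y) f ?xs \<in> T"
      by (intro subuniverse_opn[OF T]) (simp_all add: op(1))
    then show "((opn A f (map (\<lambda>g. g x\<^sub>1) gs), opn A f (map (\<lambda>g. g x\<^sub>2) gs)),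
        opn Y f (map (\<lambda>g. g y) (map G gs))) \<in> T"
      by (simp add: prod_alg_def comp_def)
  qed
qed

lemma subuniverse_image:
  assumes T: "subuniverse sig X T" and hom: "\<And>f xs. h (opn X f xs) = opn Y f (map h xs)"
    and sub: "h ` T \<subseteq> carrier Y"
  shows "subuniverse sig Y (h ` T)"
  unfolding subuniverse_def
proof (intro conjI allI impI sub)
  fix f ys assume f: "sig f = Some (length ys)" and "set ys \<subseteq> h ` T"
  from this(2) have "\<exists>zs. set zs \<subseteq> T \<and> map h zs = ys"
  proof (induction ys)
    case (Cons y ys)
    then obtain z zs where "z \<in> T" "h z = y" "set zs \<subseteq> T" "map h zs = ys" by auto
    then show ?case by (intro exI[of _ "z # zs"]) simp
  qed simp
  then obtain zs where zs: "set zs \<subseteq> T" "map h zs = ys" by blast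
  then have "opn X f zs \<in> T" using f by (intro subuniverse_opn[OF T]) auto
  then have "h (opn X f zs) \<in> h ` T" by (rule imageI)
  then show "opn Y f ys \<in> h ` T" by (simp add: hom zs)
qed

lemma subuniverse_fst:
  assumes "subuniverse sig (prod_alg X Y) T"
  shows "subuniverse sig X (fst ` T)"
  by (rule subuniverse_image[OF assms]) (use assms in \<open>auto simp: prod_alg_def subuniverse_def\<close>)

lemma subuniverse_snd:
  assumes "subuniverse sig (prod_alg X Y) T"
  shows "subuniverse sig Y (snd ` T)"
  by (rule subuniverse_image[OF assms]) (use assms in \<open>auto simp: prod_alg_def subuniverse_def\<close>)

text \<open>\<open>abelian_over\<close> speaks of terms, so the constants of a polynomial become
  variables from index 2 on, read from an enumeration \<open>cs\<close> of the carrier.\<close>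

lemma pol2_as_term:
  assumes "q \<in> pol2 sig B" "carrier B \<subseteq> range cs"
  obtains t where "wf_trm sig t" "\<And>x y. q (x, y) = eval B (case_nat x (case_nat y cs)) t"
proof -
  have "\<exists>t. wf_trm sig t \<and> (\<forall>x y. q (x, y) = eval B (case_nat x (case_nat y cs)) t)"
    using assms(1)
  proof induction
    case (var v)
    then consider "v = fst" | "v = snd" by auto
    then show ?case
    proof cases
      case 1
      then show ?thesis by (intro exI[of _ "Var 0"]) simp
    next
      case 2
      then show ?thesis by (intro exI[of _ "Var (Suc 0)"]) simp
    qed
  next
    case (const a)
    then obtain i where "a = cs i" using assms(2) by auto
    then show ?case by (intro exI[of _ "Var (Suc (Suc i))"]) simp
  next
    case (op f gs)
    then have "\<forall>g\<in>set gs. \<exists>t. wf_trm sig t \<and>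
        (\<forall>x y. g (x, y) = eval B (case_nat x (case_nat y cs)) t)" by auto
    then obtain G where G: "\<forall>g\<in>set gs. wf_trm sig (G g) \<and>
        (\<forall>x y. g (x, y) = eval B (case_nat x (case_nat y cs)) (G g))" by metis
    have "wf_trm sig (App f (map G gs))" using op(1) G by simp
    moreover have "opn B f (map (\<lambda>g. g (x, y)) gs) =
        eval B (case_nat x (case_nat y cs)) (App f (map G gs))" for x y
      using G by (auto simp: comp_def intro!: arg_cong[where f = "opn B f"])
    ultimately show ?case by blast
  qed
  then show thesis using that by blast
qed

lemma abelian_pol2:
  assumes alg: "is_algebra sig B" and fin: "finite (carrier B)" and con: "\<nu> \<in> Con sig B"
    and abelian: "abelian_over sig B \<nu> (Id_on (carrier B))"
    and q: "q \<in> pol2 sig B" and uv: "(u, v) \<in> \<nu>" and cd: "(c, d) \<in> \<nu>" and eq: "q (u, c) = q (u, d)"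
  shows "q (v, c) = q (v, d)"
proof -
  have C: "u \<in> carrier B" "c \<in> carrier B" using ConD(1)[OF con] uv cd by auto
  obtain n and f :: "nat \<Rightarrow> 'b" where f: "carrier B = f ` {i. i < n}"
    using fin finite_conv_nat_seg_image by metis
  \<comment> \<open>Past \<open>n\<close> the enumeration repeats \<open>u\<close>, so that all
    entries lie in the carrier and are \<nu>-related to themselves.\<close>
  define cs where "cs i = (if i < n then f i else u)" for i
  have "carrier B \<subseteq> range cs" unfolding f cs_def by auto
  then obtain t where t: "wf_trm sig t"
    "\<And>x y. q (x, y) = eval B (case_nat x (case_nat y cs)) t" using pol2_as_term[OF q] by blast
  have "cs j \<in> carrier B" for j using f C by (auto simp: cs_def)
  then have "(cs j, cs j) \<in> \<nu>" for j using ConD(2)[OF con] by auto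
  then have cs: "(case_nat c cs j, case_nat d cs j) \<in> \<nu>" for j using cd by (auto split: nat.split)
  have "(eval B (case_nat u (case_nat c cs)) t, eval B (case_nat u (case_nat d cs)) t)
      \<in> Id_on (carrier B)"
    using eq pol2_closed[OF alg q C] by (auto simp flip: t(2))
  then have "(eval B (case_nat v (case_nat c cs)) t, eval B (case_nat v (case_nat d cs)) t)
      \<in> Id_on (carrier B)"
    by (rule abelian[unfolded abelian_over_def, rule_format, OF t(1) uv cs])
  then show ?thesis by (auto simp flip: t(2))
qed

lemma (in monolith) pseudo_meet_not_linked_to_abelian:
  assumes algB: "is_algebra sig B" and finB: "finite (carrier B)" and \<nu>: "\<nu> \<in> Con sig B"
    and abelian: "abelian_over sig B \<nu> (Id_on (carrier B))"
    and T: "subuniverse sig (prod_alg (prod_alg A A) (prod_alg B B)) T"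
    and fstT: "Id_on (carrier A) \<subseteq> fst ` T"
    and sndT: "Id_on (carrier B) \<subseteq> snd ` T" "snd ` T \<subseteq> \<nu>"
    and diag: "\<And>s r. (s, r) \<in> T \<Longrightarrow> s \<in> Id_on (carrier A) \<longleftrightarrow> r \<in> Id_on (carrier B)"
    and p: "p \<in> pol2 sig A" "p (i, i) = i" "p (i, l) = l" "p (l, i) = l" "p (l, l) = l"
    and io: "(i, l) \<in> \<mu>" "i \<noteq> l" "(i, l) \<in> fst ` T"
  shows False
proof -
  have algA: "is_algebra sig A" by (rule alg)
  define C where "C = (prod_alg B B)\<lparr>carrier := snd ` T\<rparr>"
  have carC: "carrier C = snd ` T" and opnC: "opn C = opn (prod_alg B B)" by (simp_all add: C_def)
  have \<nu>B: "\<nu> \<subseteq> carrier B \<times> carrier B" using ConD(1)[OF \<nu>] .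
  have CB: "snd ` T \<subseteq> carrier B \<times> carrier B" using sndT \<nu>B by blast
  have subC: "subuniverse sig C (carrier C)"
    using subuniverse_snd[OF T] by (auto simp: subuniverse_def carC opnC)
  have algC: "is_algebra sig C"
    using subC algB sndT(1) unfolding is_algebra_def carC by blast
  have finC: "finite (carrier C)" unfolding carC
    by (rule finite_subset[OF CB]) (simp add: finB)
  have "T \<subseteq> carrier (prod_alg A A) \<times> snd ` T"
    using T unfolding subuniverse_def prod_alg_def[of "prod_alg A A"] by force
  moreover have "opn (prod_alg (prod_alg A A) C) = opn (prod_alg (prod_alg A A) (prod_alg B B))"
    by (simp add: prod_alg_def opnC)
  ultimately have TC: "subuniverse sig (prod_alg (prod_alg A A) C) T"
    using T unfolding subuniverse_def by (simp add: prod_alg_def[of _ C] carC)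
  have TcC: "r \<in> carrier C" if "(s, r) \<in> T" for s r using that by (force simp: carC)
  have TcA: "x \<in> carrier A" "y \<in> carrier A" if "((x, y), r) \<in> T" for x y r
    using T that by (auto simp: subuniverse_def prod_alg_def)

  define \<eta> where "\<eta> = {(r, r') \<in> carrier C \<times> carrier C. fst r = fst r'}"
  have eta: "\<eta> \<in> Con sig C"
  proof -
    have "equiv (carrier C) \<eta>" by (auto simp: \<eta>_def equiv_def refl_on_def sym_def trans_def)
    moreover have "opn (prod_alg C C) f xs \<in> \<eta>"
      if f: "sig f = Some (length xs)" and xs: "set xs \<subseteq> \<eta>" for f xs
    proof -
      have "map (fst \<circ> fst) xs = map (fst \<circ> snd) xs" using xs by (auto simp: \<eta>_def)
      moreover have "set (map fst xs) \<subseteq> carrier C" "set (map snd xs) \<subseteq> carrier C"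
        using xs by (force simp: \<eta>_def)+
      then have "opn C f (map fst xs) \<in> carrier C" "opn C f (map snd xs) \<in> carrier C"
        using f by (simp_all add: subuniverse_opn[OF subC])
      ultimately show ?thesis
        by (auto simp: \<eta>_def prod_alg_def opnC intro!: arg_cong[where f = "opn B f"])
    qed
    ultimately show ?thesis
      by (auto simp: Con_def subuniverse_def prod_alg_def \<eta>_def)
  qed

  \<comment> \<open>The syntactic congruence of the diagonal within \<open>C\<close>.\<close>
  define \<Psi> where "\<Psi> = {(r, r') \<in> carrier C \<times> carrier C.
    \<forall>g\<in>pol1 sig C. (g r \<in> Id_on (carrier B)) = (g r' \<in> Id_on (carrier B))}"
  have Psi: "\<Psi> \<in> Con sig C" unfolding \<Psi>_def
  proof (rule ConI_kernel[OF algC])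
    fix g f assume gf: "g \<in> pol1 sig C" "f \<in> pol1 sig C"
    show "\<exists>j\<in>pol1 sig C. \<forall>a\<in>carrier C.
        (j a \<in> Id_on (carrier B)) = (g (f a) \<in> Id_on (carrier B))"
      by (intro bexI[OF _ polys_comp1[OF gf]]) simp
  qed

  interpret abelian_mod sig C \<eta> \<Psi>
  proof
    fix q u v c d
    assume q: "q \<in> pol2 sig C" and uv: "(u, v) \<in> \<eta>" and cd: "(c, d) \<in> \<eta>" and eq: "q (u, c) = q (u, d)"
    have "\<exists>q'\<in>pol2 sig B. \<forall>p. snd (q p) = q' ((\<lambda>p. (snd (fst p), snd (snd p))) p)"
      by (rule polys_hom[OF _ _ q]) (use CB in \<open>auto simp: opnC carC prod_alg_def\<close>)
    then obtain q' where q': "q' \<in> pol2 sig B" "\<And>x y. snd (q (x, y)) = q' (snd x, snd y)" by auto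
    \<comment> \<open>\<open>C\<close> lies in \<nu>, so elements with the same first coordinate
      have \<nu>-related second coordinates; this is how \<eta> inherits abelianness from
      \<nu>.\<close>
    have mu: "(snd x, snd y) \<in> \<nu>" if "(x, y) \<in> \<eta>" for x y
    proof -
      have "x \<in> \<nu>" "y \<in> \<nu>" "fst x = fst y" using that sndT(2) by (auto simp: \<eta>_def carC)
      then show ?thesis using ConD(3,4)[OF \<nu>] by (metis prod.collapse symD transD)
    qed
    have "snd (q (v, c)) = snd (q (v, d))"
      using abelian_pol2[OF algB finB \<nu> abelian q'(1) mu[OF uv] mu[OF cd]] eq
      by (metis q'(2))
    moreover have "v \<in> carrier C" using uv by (simp add: \<eta>_def)
    then have "(q (v, c), q (v, d)) \<in> \<eta>" by (intro Con_pol1[OF eta pol2_right[OF q] cd])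
    then have "fst (q (v, c)) = fst (q (v, d))" by (simp add: \<eta>_def)
    ultimately show "q (v, c) = q (v, d)" by (simp add: prod_eq_iff)
  qed (use algC finC eta Psi in auto)

  have lifts: "\<exists>r\<in>carrier C. ((x, x), r) \<in> T" if "x \<in> carrier A" for x
    using fstT that TcC by force
  \<comment> \<open>Having a common partner in \<open>T\<close> is a reflexive compatible relation,
    so polynomials of \<open>C\<close> preserve it; by \<open>diag\<close> two elements with a
    common partner are both on the diagonal or both off it.\<close>
  have same: "(r, r') \<in> \<Psi>" if "(s, r) \<in> T" "(s, r') \<in> T" for s r r'
  proof -
    let ?R = "{(r, r'). \<exists>s. (s, r) \<in> T \<and> (s, r') \<in> T}"
    have R: "subuniverse sig (prod_alg C C) ?R"
      unfolding subuniverse_def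
    proof (intro conjI allI impI)
      show "?R \<subseteq> carrier (prod_alg C C)" using TcC by (auto simp: prod_alg_def)
      fix f xs assume f: "sig f = Some (length xs)" and "set xs \<subseteq> ?R"
      from this(2) have "\<exists>ss. length ss = length xs \<and> set (zip ss (map fst xs)) \<subseteq> T \<and>
          set (zip ss (map snd xs)) \<subseteq> T"
      proof (induction xs)
        case (Cons x xs)
        then obtain ss where "length ss = length xs" "set (zip ss (map fst xs)) \<subseteq> T"
          "set (zip ss (map snd xs)) \<subseteq> T" by auto
        moreover obtain s where "(s, fst x) \<in> T" "(s, snd x) \<in> T" using Cons.prems by auto
        ultimately show ?case by (intro exI[of _ "s # ss"]) auto
      qed simp
      then obtain ss where ss: "length ss = length xs" "set (zip ss (map fst xs)) \<subseteq> T"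
        "set (zip ss (map snd xs)) \<subseteq> T" by blast
      have "opn (prod_alg (prod_alg A A) C) f (zip ss rs) \<in> T"
        if "length rs = length xs" "set (zip ss rs) \<subseteq> T" for rs
        using f that ss(1) by (intro subuniverse_opn[OF TC]) auto
      from this[of "map fst xs"] this[of "map snd xs"] ss
      have "(opn (prod_alg A A) f ss, opn C f (map fst xs)) \<in> T"
        "(opn (prod_alg A A) f ss, opn C f (map snd xs)) \<in> T"
        by (simp_all add: prod_alg_def[of "prod_alg A A"])
      then show "opn (prod_alg C C) f xs \<in> ?R"
        by (simp add: prod_alg_def[of C] del: split_paired_Ex) blast
    qed
    have "Id_on (carrier C) \<subseteq> ?R" by (auto simp: carC) blast
    then have "(g r, g r') \<in> ?R" if "g \<in> pol1 sig C" for g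
      by (rule polys_rel[OF R _ that]) (use \<open>(s, r) \<in> T\<close> \<open>(s, r') \<in> T\<close> in \<open>auto simp del: split_paired_Ex\<close>)
    then have "(g r \<in> Id_on (carrier B)) = (g r' \<in> Id_on (carrier B))" if g: "g \<in> pol1 sig C" for g
    proof -
      obtain s' where "(s', g r) \<in> T" "(s', g r') \<in> T"
        using \<open>\<And>g. g \<in> pol1 sig C \<Longrightarrow> (g r, g r') \<in> ?R\<close>[OF g] by (elim CollectE case_prodE) auto
      from diag[OF this(1)] diag[OF this(2)] show ?thesis by simp
    qed
    then show ?thesis using that TcC by (auto simp: \<Psi>_def)
  qed
  have Psi_diag: "r \<in> Id_on (carrier B) \<longleftrightarrow> r' \<in> Id_on (carrier B)" if "(r, r') \<in> \<Psi>" for r r'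
  proof -
    have "\<forall>g\<in>pol1 sig C. (g r \<in> Id_on (carrier B)) = (g r' \<in> Id_on (carrier B))"
      using that by (simp add: \<Psi>_def)
    from bspec[OF this pol1_id] show ?thesis .
  qed

  let ?D = "{((x, x'), (y, y'), (r, r')) | x x' y y' r r'. ((x, y), r) \<in> T \<and> ((x', y'), r') \<in> T}"
  have "\<exists>P\<in>pol2 sig C. \<forall>(a, b, r)\<in>?D. ((p a, p b), P r) \<in> T"
    by (rule polys_lift_diagonal[OF TC lifts _ p(1)]) auto
  then obtain P where P: "P \<in> pol2 sig C"
    and PT: "\<And>x x' y y' r r'. ((x, y), r) \<in> T \<Longrightarrow> ((x', y'), r') \<in> T \<Longrightarrow>
      ((p (x, x'), p (y, y')), P (r, r')) \<in> T" by auto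

  \<comment> \<open>\<epsilon> pulled back to \<open>A\<close> along lifts of diagonal pairs. The
    choice of lift is immaterial: by \<open>same\<close> and \<open>Psi_eps\<close> two lifts of one
    pair are \<epsilon>-related.\<close>
  define \<kappa> where "\<kappa> = {(x, y). \<exists>r r'. ((x, x), r) \<in> T \<and> ((y, y), r') \<in> T \<and> (r, r') \<in> \<epsilon>}"
  have kappa_sub: "\<kappa> \<subseteq> carrier A \<times> carrier A" using TcA by (auto simp: \<kappa>_def)
  have kappa: "\<kappa> \<in> Con sig A"
  proof (rule ConI_pol1[OF algA _ kappa_sub])
    have "sym \<kappa>" unfolding \<kappa>_def by (rule symI) (use eps_sym in blast)
    moreover have "trans \<kappa>"
    proof (rule transI)
      fix x y z assume "(x, y) \<in> \<kappa>" "(y, z) \<in> \<kappa>"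
      then obtain a b b' c where abc: "((x, x), a) \<in> T" "((y, y), b) \<in> T" "(a, b) \<in> \<epsilon>"
        "((y, y), b') \<in> T" "((z, z), c) \<in> T" "(b', c) \<in> \<epsilon>" by (auto simp: \<kappa>_def)
      have "(a, c) \<in> \<epsilon>"
        using eps_trans[OF eps_trans[OF abc(3) Psi_eps[OF same[OF abc(2,4)]]] abc(6)] .
      then show "(x, z) \<in> \<kappa>" using abc(1,5) unfolding \<kappa>_def by blast
    qed
    moreover have "(x, x) \<in> \<kappa>" if "x \<in> carrier A" for x
      using lifts[OF that] eps_refl unfolding \<kappa>_def by blast
    ultimately show "equiv (carrier A) \<kappa>" using kappa_sub by (auto simp: equiv_def refl_on_def)
  next
    fix f x y assume f: "f \<in> pol1 sig A" and "(x, y) \<in> \<kappa>"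
    then obtain r r' where r: "((x, x), r) \<in> T" "((y, y), r') \<in> T" "(r, r') \<in> \<epsilon>"
      by (auto simp: \<kappa>_def)
    have "\<exists>F\<in>pol1 sig C. \<forall>(a, b, r)\<in>{(x, x, r) | x r. ((x, x), r) \<in> T}. ((f a, f b), F r) \<in> T"
      by (rule polys_lift_diagonal[OF TC lifts _ f]) auto
    then obtain F where F: "F \<in> pol1 sig C" "\<And>x r. ((x, x), r) \<in> T \<Longrightarrow> ((f x, f x), F r) \<in> T"
      by auto
    then show "(f x, f y) \<in> \<kappa>" using r Con_pol1[OF eps F(1) r(3)] unfolding \<kappa>_def by blast
  qed

  obtain r where r: "((i, l), r) \<in> T" using io(3) by auto
  have ioC: "i \<in> carrier A" "l \<in> carrier A" using mu_carrier[OF io(1)] by auto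
  obtain ri ro where ri: "((i, i), ri) \<in> T" and ro: "((l, l), ro) \<in> T" using lifts ioC by blast
  have rd: "r \<notin> Id_on (carrier B)" using diag[OF r] io(2) by auto
  have carrC: "r \<in> carrier C" "ri \<in> carrier C" "ro \<in> carrier C" using TcC r ri ro by auto

  \<comment> \<open>Otherwise some lifts of \<open>(i, i)\<close> and \<open>(l, l)\<close> are
    \<epsilon>-related; \<open>P\<close> is a meet on them modulo \<Psi>, so they are
    \<Psi>-related. Applying \<open>P (_, r)\<close> gives \<Psi>-related elements over
    \<open>(i, l)\<close> and \<open>(l, l)\<close>, of which only the second is on the
    diagonal.\<close>
  have "\<not> \<mu> \<subseteq> \<kappa>"
  proof
    assume "\<mu> \<subseteq> \<kappa>"
    then obtain r1 r0 where r1: "((i, i), r1) \<in> T" and r0: "((l, l), r0) \<in> T" and e: "(r1, r0) \<in> \<epsilon>"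
      using io(1) by (auto simp: \<kappa>_def)
    have "(r1, r0) \<in> \<Psi>"
      by (rule no_pseudo_meet[OF e P]; rule same)
        (use PT[OF r1 r1] PT[OF r1 r0] PT[OF r0 r1] PT[OF r0 r0] p r1 r0 in simp_all)
    then have "(P (r1, r), P (r0, r)) \<in> \<Psi>"
      by (rule Con_pol1[OF Psi pol2_left[OF P carrC(1)]])
    moreover have "((i, l), P (r1, r)) \<in> T" "((l, l), P (r0, r)) \<in> T"
      using PT[OF r1 r] PT[OF r0 r] p by simp_all
    ultimately show False using Psi_diag diag io(2) ioC by blast
  qed
  \<comment> \<open>Leastness of \<mu> leaves only equality for \<kappa>, so \<epsilon>-related
    elements over diagonal pairs lie over the same one.\<close>
  then have kappa_eq: "x = y" if "(x, y) \<in> \<kappa>" for x y using least[OF kappa] that by auto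

  \<comment> \<open>The diagonal element \<eta>-related to \<open>r\<close>; its partner in
    \<open>T\<close> is diagonal too, some \<open>(z, z)\<close>.\<close>
  define rz where "rz = (fst r, fst r)"
  have "fst r \<in> carrier B" using carrC(1) CB unfolding carC by auto
  then have rzB: "rz \<in> Id_on (carrier B)" by (auto simp: rz_def)
  then have rzC: "rz \<in> carrier C" using sndT(1) carC by blast
  then obtain s where s: "(s, rz) \<in> T" unfolding carC by auto
  then obtain z where rz: "((z, z), rz) \<in> T" using diag rzB by (metis Id_onE)
  have zC: "z \<in> carrier A" using TcA(1)[OF rz] .
  have e: "(r, rz) \<in> \<epsilon>"
    by (rule eta_eps) (use carrC(1) rzC in \<open>simp add: \<eta>_def rz_def\<close>)
  have PL: "(P (r, a), P (rz, a)) \<in> \<epsilon>" if "a \<in> carrier C" for a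
    by (rule Con_pol1[OF eps pol2_left[OF P that] e])
  have PR: "(P (a, r), P (a, rz)) \<in> \<epsilon>" if "a \<in> carrier C" for a
    by (rule Con_pol1[OF eps pol2_right[OF P that] e])
  have lift_r: "(a, rz) \<in> \<epsilon>" if "((i, l), a) \<in> T" for a
    using Psi_eps[OF same[OF that r]] e by (rule eps_trans)
  have kappaI: "x = y" if "((x, x), a) \<in> T" "((y, y), b) \<in> T" "(a, b) \<in> \<epsilon>" for x y a b
    by (rule kappa_eq) (use that in \<open>unfold \<kappa>_def, blast\<close>)
  \<comment> \<open>Replacing \<open>rz\<close> by \<open>r\<close> stays within an
    \<epsilon>-class, and \<open>P (r, ro)\<close> lies over
    \<open>(p (i, l), p (l, l)) = (l, l)\<close>.\<close>
  have pzo: "p (z, l) = l"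
    by (rule kappaI[OF PT[OF rz ro] _ eps_sym[OF PL[OF carrC(3)]]]) (use PT[OF r ro] p in simp)
  have poz: "p (l, z) = l"
    by (rule kappaI[OF PT[OF ro rz] _ eps_sym[OF PR[OF carrC(3)]]]) (use PT[OF ro r] p in simp)
  \<comment> \<open>Here the replacement gives an element over \<open>(i, l)\<close>, which is
    \<epsilon>-related to \<open>rz\<close>, so the value must be \<open>z\<close>.\<close>
  have pzi: "p (z, i) = z"
    by (rule kappaI[OF PT[OF rz ri] rz eps_trans[OF eps_sym[OF PL[OF carrC(2)]] lift_r]])
      (use PT[OF r ri] p in simp)
  have piz: "p (i, z) = z"
    by (rule kappaI[OF PT[OF ri rz] rz eps_trans[OF eps_sym[OF PR[OF carrC(2)]] lift_r]])
      (use PT[OF ri r] p in simp)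
  have Prr: "(P (r, r), rz) \<in> \<epsilon>" by (rule lift_r) (use PT[OF r r] p in simp)
  have Pzr: "(P (rz, r), rz) \<in> \<epsilon>" using eps_sym[OF PL[OF carrC(1)]] Prr by (rule eps_trans)
  have pzz: "p (z, z) = z"
    by (rule kappaI[OF PT[OF rz rz] rz eps_trans[OF eps_sym[OF PR[OF rzC]] Pzr]])

  \<comment> \<open>\<open>v\<close> lies over \<open>(z, l)\<close>, and \<open>P\<close> is a meet
    on \<open>rz\<close> and \<open>v\<close> modulo \<Psi>; so \<open>v\<close> is on the diagonal,
    which gives \<open>z = l\<close>.\<close>
  define v where "v = P (rz, r)"
  have v: "((z, l), v) \<in> T" using PT[OF rz r] pzi pzo by (simp add: v_def)
  have "(rz, v) \<in> \<Psi>"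
    by (rule no_pseudo_meet[OF _ P]; (rule same)?)
      (use PT[OF rz rz] PT[OF rz v] PT[OF v rz] PT[OF v v] pzz pzo poz p(5) rz v
        eps_sym[OF Pzr] in \<open>simp_all add: v_def\<close>)
  then have "v \<in> Id_on (carrier B)" using Psi_diag rzB by blast
  then have "z = l" using diag[OF v] by auto
  then have "(r, rz) \<in> \<Psi>"
    by (intro no_pseudo_meet[OF e P]; intro same)
      (use PT[OF r r] PT[OF r rz] PT[OF rz r] PT[OF rz rz] p r rz in simp_all)
  then show False using Psi_diag rzB rd by blast
qed

text \<open>The minimal set is taken with its pair inside the first projection of \<open>T\<close>,
  so that the pseudo-meet supplied by nonabelianness acts on a linked pair.\<close>

lemma (in monolith) abelian_if_linked_to_abelian:
  assumes algB: "is_algebra sig B" and finB: "finite (carrier B)" and \<nu>: "\<nu> \<in> Con sig B"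
    and abelian: "abelian_over sig B \<nu> (Id_on (carrier B))"
    and T: "subuniverse sig (prod_alg (prod_alg A A) (prod_alg B B)) T"
    and fstT: "Id_on (carrier A) \<subset> fst ` T" "fst ` T \<subseteq> \<mu>"
    and sndT: "Id_on (carrier B) \<subseteq> snd ` T" "snd ` T \<subseteq> \<nu>"
    and diag: "\<And>s r. (s, r) \<in> T \<Longrightarrow> s \<in> Id_on (carrier A) \<longleftrightarrow> r \<in> Id_on (carrier B)"
  shows "abelian_over sig A \<mu> (Id_on (carrier A))"
proof (rule ccontr)
  assume not_abelian: "\<not> ?thesis"
  obtain e x\<^sub>0 y\<^sub>0 where m: "minimal_set sig A \<mu> e x\<^sub>0 y\<^sub>0" and xyT: "(x\<^sub>0, y\<^sub>0) \<in> fst ` T"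
    using obtain_minimal_set[OF subuniverse_fst[OF T] fstT] by blast
  obtain p i l where p: "p \<in> pol2 sig A" "p (i, i) = i" "p (i, l) = l" "p (l, i) = l" "p (l, l) = l"
    and il: "{i, l} = {x\<^sub>0, y\<^sub>0}"
    using minimal_set.abelian_or_pseudo_meet[OF m not_abelian] by metis
  have xy: "(x\<^sub>0, y\<^sub>0) \<in> \<mu>" "x\<^sub>0 \<noteq> y\<^sub>0" using minimal_set.xy[OF m] by auto
  have sym: "(y, x) \<in> \<mu>" if "(x, y) \<in> \<mu>" for x y using ConD(3)[OF con] that by (auto dest: symD)
  consider "i = x\<^sub>0" "l = y\<^sub>0" | "i = y\<^sub>0" "l = x\<^sub>0" using il by (auto simp: doubleton_eq_iff)
  then show False
  proof cases
    case 1
    show False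
      by (rule pseudo_meet_not_linked_to_abelian[OF algB finB \<nu> abelian T _ sndT diag p])
        (use 1 xy xyT fstT in auto)
  next
    case 2
    \<comment> \<open>With bottom \<open>x\<^sub>0\<close> the pair is wanted in the other order,
      and the projection of \<open>T\<close> may fail to be symmetric; swapping both pairs in every
      quadruple repairs this.\<close>
    define T' where "T' = map_prod prod.swap prod.swap ` T"
    have in_T': "(s, r) \<in> T' \<longleftrightarrow> (prod.swap s, prod.swap r) \<in> T" for s r
      unfolding T'_def by (cases s; cases r) force
    have T': "subuniverse sig (prod_alg (prod_alg A A) (prod_alg B B)) T'"
      unfolding T'_def
      by (rule subuniverse_image[OF T])
        (use T in \<open>auto simp: prod_alg_def subuniverse_def comp_def\<close>)
    have img: "fst ` T' = prod.swap ` fst ` T" "snd ` T' = prod.swap ` snd ` T"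
      unfolding T'_def by (simp_all add: image_image)
    have "prod.swap ` Id_on (carrier A) \<subseteq> prod.swap ` fst ` T"
      "prod.swap ` Id_on (carrier B) \<subseteq> prod.swap ` snd ` T"
      using fstT(1) sndT(1) by (intro image_mono; blast)+
    moreover have "prod.swap ` Id_on (carrier A) = Id_on (carrier A)"
      "prod.swap ` Id_on (carrier B) = Id_on (carrier B)" by force+
    ultimately have Id: "Id_on (carrier A) \<subseteq> fst ` T'" "Id_on (carrier B) \<subseteq> snd ` T'"
      unfolding img by simp_all
    have "snd ` T' \<subseteq> \<nu>"
      unfolding img using sndT(2) ConD(3)[OF \<nu>] by (force dest: symD)
    moreover have "(i, l) \<in> fst ` T'" unfolding img using 2 xyT by force
    moreover have "s \<in> Id_on (carrier A) \<longleftrightarrow> r \<in> Id_on (carrier B)" if "(s, r) \<in> T'" for s r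
      using diag[of "prod.swap s" "prod.swap r"] that unfolding in_T' by (cases s; cases r) auto
    moreover have "(i, l) \<in> \<mu>" "i \<noteq> l" using 2 xy sym by auto
    ultimately show False
      using pseudo_meet_not_linked_to_abelian[OF algB finB \<nu> abelian T' Id _ _ p] by blast
  qed
qed

section \<open>Quotients on representatives\<close>

definition rep :: "'a rel \<Rightarrow> 'a \<Rightarrow> 'a" where
  "rep \<rho> x = (SOME y. (x, y) \<in> \<rho>)"

text \<open>Elements are chosen representatives instead of classes: the type stays
  \<open>'a\<close>, and a relation saturated by \<rho> passes to the quotient by
  restriction.\<close>

definition quot :: "('f, 'a) algebra \<Rightarrow> 'a rel \<Rightarrow> ('f, 'a) algebra" where
  "quot A \<rho> = \<lparr>carrier = rep \<rho> ` carrier A, opn = (\<lambda>f xs. rep \<rho> (opn A f xs))\<rparr>"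

lemma eval_closed:
  "is_algebra sig A \<Longrightarrow> wf_trm sig t \<Longrightarrow> \<forall>i. v i \<in> carrier A \<Longrightarrow> eval A v t \<in> carrier A"
proof (induction t)
  case (App f ts)
  then show ?case by (auto simp: is_algebra_def intro!: subuniverse_opn[of sig A "carrier A"])
qed simp

locale congruence =
  fixes sig :: "'f \<rightharpoonup> nat" and A :: "('f, 'a) algebra" and \<rho> :: "'a rel"
  assumes alg: "is_algebra sig A" and rho: "\<rho> \<in> Con sig A"
begin

abbreviation "Q \<equiv> carrier (quot A \<rho>)"

lemma carrier_quot: "Q = rep \<rho> ` carrier A" and opn_quot: "opn (quot A \<rho>) f xs = rep \<rho> (opn A f xs)"
  by (simp_all add: quot_def)

lemma rep_rel: "x \<in> carrier A \<Longrightarrow> (x, rep \<rho> x) \<in> \<rho>"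
  unfolding rep_def by (rule someI[of _ x]) (use ConD(2)[OF rho] in auto)

lemma rep_closed: "x \<in> carrier A \<Longrightarrow> rep \<rho> x \<in> carrier A"
  using rep_rel ConD(1)[OF rho] by blast

lemma rho_sym: "(x, y) \<in> \<rho> \<Longrightarrow> (y, x) \<in> \<rho>"
  and rho_trans: "(x, y) \<in> \<rho> \<Longrightarrow> (y, z) \<in> \<rho> \<Longrightarrow> (x, z) \<in> \<rho>"
  using ConD(3,4)[OF rho] by (auto dest: symD transD)

lemma rep_eq: "(x, y) \<in> \<rho> \<Longrightarrow> rep \<rho> x = rep \<rho> y"
  unfolding rep_def by (rule arg_cong[where f = Eps]) (use rho_sym rho_trans in blast)

lemma rep_eq_iff: "x \<in> carrier A \<Longrightarrow> y \<in> carrier A \<Longrightarrow> rep \<rho> x = rep \<rho> y \<longleftrightarrow> (x, y) \<in> \<rho>"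
  using rep_eq rep_rel rho_sym rho_trans by metis

lemma Q_sub: "Q \<subseteq> carrier A"
  unfolding carrier_quot using rep_closed by auto

lemma rep_Q: "x \<in> Q \<Longrightarrow> rep \<rho> x = x"
  unfolding carrier_quot using rep_eq rep_rel by force

lemma rep_in_Q: "x \<in> carrier A \<Longrightarrow> rep \<rho> x \<in> Q"
  unfolding carrier_quot by simp

lemma opn_closed: "sig f = Some (length xs) \<Longrightarrow> set xs \<subseteq> carrier A \<Longrightarrow> opn A f xs \<in> carrier A"
  using alg by (simp add: is_algebra_def subuniverse_def)

lemma is_algebra_quot: "is_algebra sig (quot A \<rho>)"
proof -
  have "Q \<noteq> {}" using alg by (simp add: is_algebra_def carrier_quot)
  moreover have "opn (quot A \<rho>) f xs \<in> Q" if "sig f = Some (length xs)" "set xs \<subseteq> Q" for f xs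
    unfolding opn_quot using that Q_sub by (intro rep_in_Q opn_closed) auto
  ultimately show ?thesis by (simp add: is_algebra_def subuniverse_def)
qed

lemma opn_rep:
  assumes "sig f = Some (length xs)" "set xs \<subseteq> carrier A"
  shows "rep \<rho> (opn A f (map (rep \<rho>) xs)) = rep \<rho> (opn A f xs)"
proof -
  have "opn (prod_alg A A) f (map (\<lambda>x. (rep \<rho> x, x)) xs) \<in> \<rho>"
    by (rule subuniverse_opn[OF ConD(5)[OF rho]]) (use assms rep_rel rho_sym in auto)
  then show ?thesis by (intro rep_eq) (simp add: prod_alg_def comp_def)
qed

lemma eval_quot:
  "wf_trm sig t \<Longrightarrow> \<forall>i. v i \<in> carrier A \<Longrightarrow> eval (quot A \<rho>) (\<lambda>i. rep \<rho> (v i)) t = rep \<rho> (eval A v t)"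
proof (induction t)
  case (App f ts)
  have "eval (quot A \<rho>) (\<lambda>i. rep \<rho> (v i)) (App f ts) =
      rep \<rho> (opn A f (map (rep \<rho>) (map (eval A v) ts)))"
    using App by (auto simp: opn_quot comp_def intro!: arg_cong[where f = "\<lambda>xs. rep \<rho> (opn A f xs)"])
  also have "\<dots> = rep \<rho> (opn A f (map (eval A v) ts))"
    by (rule opn_rep) (use App.prems eval_closed[OF alg] in auto)
  finally show ?case by simp
qed simp

lemma Con_quot:
  assumes \<mu>: "\<mu> \<in> Con sig A" and "\<rho> \<subseteq> \<mu>"
  shows "\<mu> \<inter> Q \<times> Q \<in> Con sig (quot A \<rho>)"
proof -
  have sym: "(y, x) \<in> \<mu>" if "(x, y) \<in> \<mu>" for x y using ConD(3)[OF \<mu>] that by (auto dest: symD)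
  have tr: "(x, z) \<in> \<mu>" if "(x, y) \<in> \<mu>" "(y, z) \<in> \<mu>" for x y z
    using ConD(4)[OF \<mu>] that by (auto dest: transD)
  have "equiv Q (\<mu> \<inter> Q \<times> Q)"
  proof -
    have "(x, x) \<in> \<mu>" if "x \<in> Q" for x using ConD(2)[OF \<mu>] Q_sub that by auto
    then show ?thesis unfolding equiv_def refl_on_def sym_def trans_def using sym tr by blast
  qed
  moreover have "opn (prod_alg (quot A \<rho>) (quot A \<rho>)) f xs \<in> \<mu> \<inter> Q \<times> Q"
    if f: "sig f = Some (length xs)" and xs: "set xs \<subseteq> \<mu> \<inter> Q \<times> Q" for f xs
  proof -
    let ?x = "opn A f (map fst xs)" and ?y = "opn A f (map snd xs)"
    have "opn (prod_alg A A) f xs \<in> \<mu>"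
      by (rule subuniverse_opn[OF ConD(5)[OF \<mu>] f]) (use xs in auto)
    then have xy: "(?x, ?y) \<in> \<mu>" by (simp add: prod_alg_def)
    then have "?x \<in> carrier A" "?y \<in> carrier A" using ConD(1)[OF \<mu>] by auto
    then have "(rep \<rho> ?x, ?x) \<in> \<mu>" "(?y, rep \<rho> ?y) \<in> \<mu>" "rep \<rho> ?x \<in> Q" "rep \<rho> ?y \<in> Q"
      using rep_rel[of ?x] rep_rel[of ?y] rho_sym assms(2) rep_in_Q by auto
    then have "(rep \<rho> ?x, rep \<rho> ?y) \<in> \<mu> \<inter> Q \<times> Q" using tr[OF tr[OF _ xy]] by simp
    then show ?thesis by (simp add: prod_alg_def opn_quot)
  qed
  ultimately show ?thesis by (auto simp: Con_def subuniverse_def prod_alg_def)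
qed

text \<open>\<open>rep \<rho>\<close> commutes with term evaluation, so congruence modulo \<rho>
  becomes equality in the quotient. Arguments can be replaced by representatives within \<mu>
  because \<rho> \<subseteq> \<mu>.\<close>

lemma abelian_quot_iff:
  assumes \<mu>: "\<mu> \<in> Con sig A" and "\<rho> \<subseteq> \<mu>"
  shows "abelian_over sig (quot A \<rho>) (\<mu> \<inter> Q \<times> Q) (Id_on Q) \<longleftrightarrow> abelian_over sig A \<mu> \<rho>"
proof -
  have muC: "x \<in> carrier A" "y \<in> carrier A" if "(x, y) \<in> \<mu>" for x y using ConD(1)[OF \<mu>] that by auto
  have ev: "(eval A (case_nat a c) t, eval A (case_nat b d) t) \<in> \<rho> \<longleftrightarrow>
      (eval (quot A \<rho>) (case_nat (rep \<rho> a) (\<lambda>j. rep \<rho> (c j))) t,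
       eval (quot A \<rho>) (case_nat (rep \<rho> b) (\<lambda>j. rep \<rho> (d j))) t) \<in> Id_on Q"
    if "wf_trm sig t" "a \<in> carrier A" "b \<in> carrier A" "\<And>j. c j \<in> carrier A" "\<And>j. d j \<in> carrier A"
    for t a b c d
  proof -
    have v: "\<forall>i. case_nat a c i \<in> carrier A" "\<forall>i. case_nat b d i \<in> carrier A"
      using that by (auto split: nat.split)
    have "case_nat (rep \<rho> a) (\<lambda>j. rep \<rho> (c j)) = (\<lambda>i. rep \<rho> (case_nat a c i))" for a c
      by (auto split: nat.split)
    then have "eval (quot A \<rho>) (case_nat (rep \<rho> a) (\<lambda>j. rep \<rho> (c j))) t = rep \<rho> (eval A (case_nat a c) t)"
      "eval (quot A \<rho>) (case_nat (rep \<rho> b) (\<lambda>j. rep \<rho> (d j))) t = rep \<rho> (eval A (case_nat b d) t)"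
      using eval_quot[OF that(1) v(1)] eval_quot[OF that(1) v(2)] by simp_all
    then show ?thesis
      using rep_eq_iff[OF eval_closed[OF alg that(1) v(1)] eval_closed[OF alg that(1) v(2)]]
        rep_in_Q[OF eval_closed[OF alg that(1) v(1)]] by auto
  qed
  show ?thesis
  proof
    assume *: "abelian_over sig (quot A \<rho>) (\<mu> \<inter> Q \<times> Q) (Id_on Q)"
    have rep_mu: "(rep \<rho> x, rep \<rho> y) \<in> \<mu> \<inter> Q \<times> Q" if "(x, y) \<in> \<mu>" for x y
    proof -
      have "(rep \<rho> x, x) \<in> \<mu>" "(y, rep \<rho> y) \<in> \<mu>"
        using assms(2) rho_sym rep_rel muC[OF that] by blast+
      then show ?thesis using that rep_in_Q muC[OF that] ConD(4)[OF \<mu>] by (blast dest: transD)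
    qed
    show "abelian_over sig A \<mu> \<rho>" unfolding abelian_over_def
    proof (intro allI impI)
      fix t a b and c d :: "nat \<Rightarrow> 'a"
      assume t: "wf_trm sig t" and ab: "(a, b) \<in> \<mu>" and cd: "\<forall>j. (c j, d j) \<in> \<mu>"
        and eq: "(eval A (case_nat a c) t, eval A (case_nat a d) t) \<in> \<rho>"
      have C: "a \<in> carrier A" "b \<in> carrier A" "c j \<in> carrier A" "d j \<in> carrier A" for j
        using muC[OF ab] muC[OF spec[OF cd, of j]] by auto
      show "(eval A (case_nat b c) t, eval A (case_nat b d) t) \<in> \<rho>"
        unfolding ev[OF t C(2,2,3,4)]
        by (rule *[unfolded abelian_over_def, rule_format, OF t rep_mu[OF ab] rep_mu])
          (use cd eq[unfolded ev[OF t C(1,1,3,4)]] in auto)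
    qed
  next
    assume *: "abelian_over sig A \<mu> \<rho>"
    show "abelian_over sig (quot A \<rho>) (\<mu> \<inter> Q \<times> Q) (Id_on Q)" unfolding abelian_over_def
    proof (intro allI impI)
      fix t a b and c d :: "nat \<Rightarrow> 'a"
      assume t: "wf_trm sig t" and ab: "(a, b) \<in> \<mu> \<inter> Q \<times> Q"
        and cd: "\<forall>j. (c j, d j) \<in> \<mu> \<inter> Q \<times> Q"
        and eq: "(eval (quot A \<rho>) (case_nat a c) t, eval (quot A \<rho>) (case_nat a d) t) \<in> Id_on Q"
      have C: "a \<in> carrier A" "b \<in> carrier A" "c j \<in> carrier A" "d j \<in> carrier A" for j
        using ab muC[of a b] muC[of "c j" "d j"] spec[OF cd, of j] by auto
      have r: "rep \<rho> a = a" "rep \<rho> b = b" "rep \<rho> (c j) = c j" "rep \<rho> (d j) = d j" for j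
        using ab cd rep_Q by auto
      have "(eval A (case_nat a c) t, eval A (case_nat a d) t) \<in> \<rho>"
        using eq ev[OF t C(1,1,3,4)] by (simp add: r)
      then have "(eval A (case_nat b c) t, eval A (case_nat b d) t) \<in> \<rho>"
        using * t ab cd unfolding abelian_over_def by blast
      then show "(eval (quot A \<rho>) (case_nat b c) t, eval (quot A \<rho>) (case_nat b d) t) \<in> Id_on Q"
        using ev[OF t C(2,2,3,4)] by (simp add: r)
    qed
  qed
qed

text \<open>A nontrivial congruence of the quotient pulls back to one of \<open>A\<close> strictly
  above \<rho>, hence above \<mu>; on representatives, which \<open>rep \<rho>\<close> fixes, this
  is the claim.\<close>

lemma monolith_quot:
  assumes fin: "finite (carrier A)" and cover: "is_upper_cover sig A \<rho> \<mu>"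
  shows "monolith sig (quot A \<rho>) (\<mu> \<inter> Q \<times> Q)"
proof
  show "is_algebra sig (quot A \<rho>)" by (rule is_algebra_quot)
  show "finite Q" using fin by (simp add: carrier_quot)
  show "\<mu> \<inter> Q \<times> Q \<in> Con sig (quot A \<rho>)"
    using cover by (intro Con_quot) (auto simp: is_upper_cover_def)
  fix \<theta> assume \<theta>: "\<theta> \<in> Con sig (quot A \<rho>)" and neq: "\<theta> \<noteq> Id_on Q"
  define \<theta>' where "\<theta>' = {(x, y) \<in> carrier A \<times> carrier A. (rep \<rho> x, rep \<rho> y) \<in> \<theta>}"
  have "equiv (carrier A) \<theta>'"
    using ConD(2-4)[OF \<theta>] rep_in_Q
    by (auto simp: \<theta>'_def equiv_def refl_on_def Id_on_def intro!: symI transI dest: symD transD)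
  moreover have "opn (prod_alg A A) f xs \<in> \<theta>'" if f: "sig f = Some (length xs)" and xs: "set xs \<subseteq> \<theta>'"
    for f xs
  proof -
    have C: "set (map fst xs) \<subseteq> carrier A" "set (map snd xs) \<subseteq> carrier A"
      using xs by (auto simp: \<theta>'_def)
    have "opn (prod_alg (quot A \<rho>) (quot A \<rho>)) f (map (\<lambda>(x, y). (rep \<rho> x, rep \<rho> y)) xs) \<in> \<theta>"
      by (rule subuniverse_opn[OF ConD(5)[OF \<theta>]]) (use f xs in \<open>auto simp: \<theta>'_def\<close>)
    then have "(rep \<rho> (opn A f (map (rep \<rho>) (map fst xs))), rep \<rho> (opn A f (map (rep \<rho>) (map snd xs)))) \<in> \<theta>"
      by (simp add: prod_alg_def opn_quot comp_def case_prod_unfold)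
    then show ?thesis
      using opn_rep[of f "map fst xs"] opn_rep[of f "map snd xs"] opn_closed f C
      by (simp add: \<theta>'_def prod_alg_def)
  qed
  ultimately have \<theta>': "\<theta>' \<in> Con sig A"
    by (auto simp: Con_def subuniverse_def prod_alg_def \<theta>'_def)
  obtain x y where xy: "(x, y) \<in> \<theta>" "x \<noteq> y" using neq ConD(1,2)[OF \<theta>] by auto
  then have "x \<in> Q" "y \<in> Q" using ConD(1)[OF \<theta>] by auto
  then have "rep \<rho> x = x" "rep \<rho> y = y" "x \<in> carrier A" "y \<in> carrier A"
    using rep_Q Q_sub by auto
  then have "(x, y) \<in> \<theta>'" "(x, y) \<notin> \<rho>"
    using xy rep_eq[of x y] by (auto simp: \<theta>'_def)
  moreover have "\<rho> \<subseteq> \<theta>'"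
  proof (rule subrelI)
    fix x y assume xy: "(x, y) \<in> \<rho>"
    then have C: "x \<in> carrier A" "y \<in> carrier A" using ConD(1)[OF rho] by auto
    then have "(rep \<rho> x, rep \<rho> x) \<in> \<theta>" using ConD(2)[OF \<theta>] rep_in_Q[of x] by auto
    then show "(x, y) \<in> \<theta>'" using C rep_eq[OF xy] by (simp add: \<theta>'_def)
  qed
  ultimately have "\<mu> \<subseteq> \<theta>'" using cover \<theta>' by (auto simp: is_upper_cover_def)
  then show "\<mu> \<inter> Q \<times> Q \<subseteq> \<theta>" using rep_Q by (auto simp: \<theta>'_def)
qed

end

section \<open>Transfer of abelianness along a bridge\<close>

lemma bridge_converse:
  assumes "bridge sig A \<rho> B \<sigma> T"
  shows "bridge sig B \<sigma> A \<rho> (T\<inverse>)"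
proof -
  have T: "subuniverse sig (prod_alg (prod_alg A A) (prod_alg B B)) T"
    using assms by (simp add: bridge_def)
  have "T\<inverse> = prod.swap ` T" by force
  moreover have "subuniverse sig (prod_alg (prod_alg B B) (prod_alg A A)) (prod.swap ` T)"
    by (rule subuniverse_image[OF T]) (use T in \<open>auto simp: prod_alg_def subuniverse_def comp_def\<close>)
  ultimately have "subuniverse sig (prod_alg (prod_alg B B) (prod_alg A A)) (T\<inverse>)" by simp
  moreover have "fst ` T\<inverse> = snd ` T" "snd ` T\<inverse> = fst ` T" by force+
  ultimately show ?thesis using assms unfolding bridge_def by simp blast
qed

text \<open>Axiom B0* lets every quadruple of \<open>T\<close> be replaced by representatives, so
  the restriction \<open>T'\<close> is the image of \<open>T\<close> in the quotients; by B2* it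
  links diagonal pairs exactly with diagonal pairs.\<close>

lemma abelian_along_bridge:
  assumes A: "is_algebra sig A" "finite (carrier A)" and B: "is_algebra sig B" "finite (carrier B)"
    and bridge: "bridge sig A \<rho> B \<sigma> T"
    and \<mu>: "is_upper_cover sig A \<rho> \<mu>" "fst ` T \<subseteq> \<mu>"
    and \<nu>: "is_upper_cover sig B \<sigma> \<nu>" "snd ` T \<subseteq> \<nu>"
    and abelian: "abelian_over sig B \<nu> \<sigma>"
  shows "abelian_over sig A \<mu> \<rho>"
proof -
  have Cons: "\<rho> \<in> Con sig A" "\<sigma> \<in> Con sig B" and
    T: "subuniverse sig (prod_alg (prod_alg A A) (prod_alg B B)) T" and
    sat: "\<And>a\<^sub>1 a\<^sub>2 b\<^sub>1 b\<^sub>2 a\<^sub>1' a\<^sub>2' b\<^sub>1' b\<^sub>2'. ((a\<^sub>1, a\<^sub>2), (b\<^sub>1, b\<^sub>2)) \<in> T \<Longrightarrow> (a\<^sub>1, a\<^sub>1') \<in> \<rho> \<Longrightarrow>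
      (a\<^sub>2, a\<^sub>2') \<in> \<rho> \<Longrightarrow> (b\<^sub>1, b\<^sub>1') \<in> \<sigma> \<Longrightarrow> (b\<^sub>2, b\<^sub>2') \<in> \<sigma> \<Longrightarrow> ((a\<^sub>1', a\<^sub>2'), (b\<^sub>1', b\<^sub>2')) \<in> T" and
    proj: "\<rho> \<subset> fst ` T" "\<sigma> \<subset> snd ` T" and
    diag: "\<And>p q. (p, q) \<in> T \<Longrightarrow> p \<in> \<rho> \<longleftrightarrow> q \<in> \<sigma>"
    using bridge unfolding bridge_def by blast+
  interpret A: congruence sig A \<rho> by unfold_locales (use A Cons in auto)
  interpret B: congruence sig B \<sigma> by unfold_locales (use B Cons in auto)
  have \<mu>': "\<mu> \<in> Con sig A" "\<rho> \<subseteq> \<mu>" and \<nu>': "\<nu> \<in> Con sig B" "\<sigma> \<subseteq> \<nu>"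
    using \<mu>(1) \<nu>(1) by (auto simp: is_upper_cover_def)
  interpret monolith sig "quot A \<rho>" "\<mu> \<inter> A.Q \<times> A.Q" by (rule A.monolith_quot[OF A(2) \<mu>(1)])
  have TC: "a\<^sub>1 \<in> carrier A" "a\<^sub>2 \<in> carrier A" "b\<^sub>1 \<in> carrier B" "b\<^sub>2 \<in> carrier B"
    if "((a\<^sub>1, a\<^sub>2), (b\<^sub>1, b\<^sub>2)) \<in> T" for a\<^sub>1 a\<^sub>2 b\<^sub>1 b\<^sub>2
    using T that by (auto simp: subuniverse_def prod_alg_def)
  define T' where "T' = T \<inter> ((A.Q \<times> A.Q) \<times> (B.Q \<times> B.Q))"
  have rep: "((rep \<rho> a\<^sub>1, rep \<rho> a\<^sub>2), (rep \<sigma> b\<^sub>1, rep \<sigma> b\<^sub>2)) \<in> T'"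
    if "((a\<^sub>1, a\<^sub>2), (b\<^sub>1, b\<^sub>2)) \<in> T" for a\<^sub>1 a\<^sub>2 b\<^sub>1 b\<^sub>2
    using sat[OF that A.rep_rel A.rep_rel B.rep_rel B.rep_rel] TC[OF that] A.rep_in_Q B.rep_in_Q
    by (simp add: T'_def)
  have "abelian_over sig (quot A \<rho>) (\<mu> \<inter> A.Q \<times> A.Q) (Id_on A.Q)"
  proof (rule abelian_if_linked_to_abelian[where T = T'])
    show "is_algebra sig (quot B \<sigma>)" by (rule B.is_algebra_quot)
    show "finite B.Q" using B(2) by (simp add: B.carrier_quot)
    show "\<nu> \<inter> B.Q \<times> B.Q \<in> Con sig (quot B \<sigma>)" by (rule B.Con_quot[OF \<nu>'])
    show "abelian_over sig (quot B \<sigma>) (\<nu> \<inter> B.Q \<times> B.Q) (Id_on B.Q)"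
      using abelian B.abelian_quot_iff[OF \<nu>'] by blast
    show "subuniverse sig (prod_alg (prod_alg (quot A \<rho>) (quot A \<rho>)) (prod_alg (quot B \<sigma>) (quot B \<sigma>))) T'"
      unfolding subuniverse_def
    proof (intro conjI allI impI)
      show "T' \<subseteq> carrier (prod_alg (prod_alg (quot A \<rho>) (quot A \<rho>)) (prod_alg (quot B \<sigma>) (quot B \<sigma>)))"
        by (auto simp: T'_def prod_alg_def)
      fix f xs assume f: "sig f = Some (length xs)" and "set xs \<subseteq> T'"
      then have "set xs \<subseteq> T" by (auto simp: T'_def)
      from subuniverse_opn[OF T f this]
      show "opn (prod_alg (prod_alg (quot A \<rho>) (quot A \<rho>)) (prod_alg (quot B \<sigma>) (quot B \<sigma>))) f xs \<in> T'"
        using rep by (simp add: prod_alg_def A.opn_quot B.opn_quot)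
    qed
    show "fst ` T' \<subseteq> \<mu> \<inter> A.Q \<times> A.Q" "snd ` T' \<subseteq> \<nu> \<inter> B.Q \<times> B.Q"
      using \<mu>(2) \<nu>(2) by (auto simp: T'_def)
    show "s \<in> Id_on A.Q \<longleftrightarrow> r \<in> Id_on B.Q" if "(s, r) \<in> T'" for s r
    proof -
      have "s \<in> A.Q \<times> A.Q" "r \<in> B.Q \<times> B.Q" "s \<in> \<rho> \<longleftrightarrow> r \<in> \<sigma>"
        using that diag by (auto simp: T'_def)
      moreover have "(x, y) \<in> \<rho> \<longleftrightarrow> x = y" if "x \<in> A.Q" "y \<in> A.Q" for x y
        using A.rep_eq_iff[of x y] that A.Q_sub A.rep_Q by auto
      moreover have "(x, y) \<in> \<sigma> \<longleftrightarrow> x = y" if "x \<in> B.Q" "y \<in> B.Q" for x y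
        using B.rep_eq_iff[of x y] that B.Q_sub B.rep_Q by auto
      ultimately show ?thesis by (cases s; cases r) auto
    qed
    have "(x, x) \<in> fst ` T'" if x: "x \<in> A.Q" for x
    proof -
      have "(x, x) \<in> \<rho>" using x A.Q_sub ConD(2)[OF Cons(1)] by auto
      then obtain b b' where "((x, x), (b, b')) \<in> T" using proj(1) by force
      from rep[OF this] show ?thesis using A.rep_Q[OF x] by force
    qed
    then have "Id_on A.Q \<subseteq> fst ` T'" by (simp add: Id_on_def UN_subset_iff)
    moreover obtain a a' b b' where ab: "((a, a'), (b, b')) \<in> T" "(a, a') \<notin> \<rho>"
      using proj(1) by force
    then have "(rep \<rho> a, rep \<rho> a') \<in> fst ` T'" "rep \<rho> a \<noteq> rep \<rho> a'"
      using rep[OF ab(1)] A.rep_eq_iff TC[OF ab(1)] by force+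
    then have "Id_on A.Q \<noteq> fst ` T'" by (metis Id_onE Pair_inject)
    ultimately show "Id_on A.Q \<subset> fst ` T'" by (rule psubsetI)
    show "Id_on B.Q \<subseteq> snd ` T'"
    proof
      fix r assume "r \<in> Id_on B.Q"
      then obtain x where x: "r = (x, x)" "x \<in> B.Q" by auto
      then have "(x, x) \<in> \<sigma>" using B.Q_sub ConD(2)[OF Cons(2)] by auto
      then obtain a a' where "((a, a'), (x, x)) \<in> T" using proj(2) by force
      from rep[OF this] show "r \<in> snd ` T'" using B.rep_Q[OF x(2)] x(1) by force
    qed
  qed
  then show ?thesis using A.abelian_quot_iff[OF \<mu>'] by blast
qed

theorem theorem6p6:
  fixes sig :: "'f \<rightharpoonup> nat" and E :: "'f identity set"
    and A :: "('f, 'a) algebra" and B :: "('f, 'b) algebra"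
    and \<rho> :: "'a rel" and \<sigma> :: "'b rel"
  assumes "wf_identities sig E"
    and "locally_finite sig E"
    and "\<exists>n t. taylor_term sig E n t"
    and "in_variety sig E A" and "finite (carrier A)"
    and "in_variety sig E B" and "finite (carrier B)"
    and "meet_irreducible sig A \<rho>" and "meet_irreducible sig B \<sigma>"
    and "\<exists>T. good_bridge sig A \<rho> B \<sigma> T"
  shows "abelian_over sig A (upper_cover sig A \<rho>) \<rho> \<longleftrightarrow>
         abelian_over sig B (upper_cover sig B \<sigma>) \<sigma>"
proof -
  have A: "is_algebra sig A" "finite (carrier A)" and B: "is_algebra sig B" "finite (carrier B)"
    using assms by (auto simp: in_variety_def)
  have cover: "is_upper_cover sig A \<rho> (upper_cover sig A \<rho>)"
    "is_upper_cover sig B \<sigma> (upper_cover sig B \<sigma>)"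
    using assms is_upper_cover_upper_cover by blast+
  \<comment> \<open>\<open>T\<close> is the smaller bridge inside the good one; its projections
    belong to \<open>Cov_plus\<close> and so lie below the upper covers.\<close>
  obtain T \<tau> \<tau>' where T: "bridge sig A \<rho> B \<sigma> T" "fst ` T = \<tau>" "snd ` T = \<tau>'"
    and \<tau>: "\<tau> \<in> Cov_plus sig A \<rho>" "\<tau>' \<in> Cov_plus sig B \<sigma>"
    using assms(10) unfolding good_bridge_def bridge_between_def by blast
  have sub: "fst ` T \<subseteq> upper_cover sig A \<rho>" "snd ` T \<subseteq> upper_cover sig B \<sigma>"
    using T(2,3) \<tau> by (auto simp: Cov_plus_def sat_above_def)
  have "fst ` T\<inverse> \<subseteq> upper_cover sig B \<sigma>" "snd ` T\<inverse> \<subseteq> upper_cover sig A \<rho>"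
    using sub by force+
  then show ?thesis
    using abelian_along_bridge[OF A B T(1) cover(1) sub(1) cover(2) sub(2)]
      abelian_along_bridge[OF B A bridge_converse[OF T(1)] cover(2) _ cover(1)] by blast
qed

end
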